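(* Let $n\ge 2$. Let $\mathfrak{S}_{\text{sub.max}}$ be the submaximal dimension of the space of quadratic integrals of Riemannian metrics in dimension $n$, that is, the largest value of $\dim Q_2(g)$, over (local) Riemannian metrics $g$ on $n$-dimensional manifolds, that is strictly smaller than the maximal value $\mathfrak{S}_{\text{max}}=\frac{(n+1)^2((n+1)^2-1)}{12}$. Then $$\mathfrak{S}_{\text{sub.max}}\ \ge\ \frac{n(n+1)}{2}+\frac{n^2(n^2-1)}{12}.$$
   Context: All considerations are local, near a regular point. For a metric $g$ on an $n$-dimensional manifold $M$ with local coordinates $x=(x_1,\dots,x_n)$ and corresponding momenta $p=(p_1,\dots,p_n)$ on $T^*M$, let $H=\frac12 g^{ij}(x)p_ip_j$ be the Hamiltonian of the geodesic flow and $\{\cdot,\cdot\}$ the standard Poisson bracket on $T^*M$. $Q_2(g)$ denotes the real vector space of smooth functions $F=u^{kl}(x)p_kp_l$ on $T^*M$, homogeneous quadratic in the momenta (including $0$), with $\{H,F\}=0$ (quadratic integrals, equivalently Killing 2-tensors). The maximal possible value of $\dim Q_2(g)$ in dimension $n$ is $\mathfrak{S}_{\text{max}}=\frac{(n+1)^2((n+1)^2-1)}{12}$, attained precisely by metrics of constant sectional curvature. *)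

theory Defs
  imports "HOL-Analysis.Analysis" "HOL-Library.Function_Algebras"
begin

text \<open>Smoothness on an open set \<open>S\<close>. Over a finite-dimensional domain, \<open>f\<close> is of class
  $C^{k+1}$ iff it is differentiable and all its directional derivatives are of class $C^k$.\<close>

primrec Ck_on :: "nat \<Rightarrow> 'a::real_normed_vector set \<Rightarrow> ('a \<Rightarrow> 'b::real_normed_vector) \<Rightarrow> bool"
where
  "Ck_on 0 S f \<longleftrightarrow> continuous_on S f"
| "Ck_on (Suc k) S f \<longleftrightarrow>
     (\<forall>x\<in>S. f differentiable (at x)) \<and>
     (\<forall>v. Ck_on k S (\<lambda>x. frechet_derivative f (at x) v))"

definition smooth_on :: "'a::real_normed_vector set \<Rightarrow> ('a \<Rightarrow> 'b::real_normed_vector) \<Rightarrow> bool"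
  where "smooth_on S f \<longleftrightarrow> (\<forall>k. Ck_on k S f)"

text \<open>A metric in local coordinates is given by its Gram matrix \<open>g x\<close> at \<open>x\<close>; a point of the
  cotangent bundle is a pair \<open>(x, p)\<close>.\<close>

definition riemannian_metric_on :: "(real^'n::finite) set \<Rightarrow> (real^'n \<Rightarrow> real^'n^'n) \<Rightarrow> bool"
  where "riemannian_metric_on U g \<longleftrightarrow>
    smooth_on U g \<and>
    (\<forall>x\<in>U. transpose (g x) = g x \<and> (\<forall>v. v \<noteq> 0 \<longrightarrow> v \<bullet> (g x *v v) > 0))"

definition geodesic_hamiltonian ::
    "(real^'n::finite \<Rightarrow> real^'n^'n) \<Rightarrow> (real^'n) \<times> (real^'n) \<Rightarrow> real"
  where "geodesic_hamiltonian g =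
    (\<lambda>(x, p). 1/2 * (\<Sum>i\<in>UNIV. \<Sum>j\<in>UNIV. matrix_inv (g x) $ i $ j * p $ i * p $ j))"

definition poisson_bracket ::
    "((real^'n::finite) \<times> (real^'n) \<Rightarrow> real) \<Rightarrow> ((real^'n) \<times> (real^'n) \<Rightarrow> real)
      \<Rightarrow> (real^'n) \<times> (real^'n) \<Rightarrow> real"
  where "poisson_bracket F G z =
    (\<Sum>i\<in>UNIV.
        frechet_derivative F (at z) (axis i 1, 0) * frechet_derivative G (at z) (0, axis i 1)
      - frechet_derivative F (at z) (0, axis i 1) * frechet_derivative G (at z) (axis i 1, 0))"

text \<open>The quadratic integrals of \<open>g\<close> on an open set \<open>V\<close>. Functions on the cotangent bundle of \<open>V\<close>
  are represented by total functions vanishing off \<open>V \<times> UNIV\<close>, so that each is counted once.\<close>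

definition quadratic_integrals ::
    "(real^'n::finite) set \<Rightarrow> (real^'n \<Rightarrow> real^'n^'n) \<Rightarrow> ((real^'n) \<times> (real^'n) \<Rightarrow> real) set"
  where "quadratic_integrals V g =
    {F. smooth_on (V \<times> UNIV) F \<and>
        (\<exists>u :: real^'n \<Rightarrow> real^'n^'n. \<forall>x\<in>V. \<forall>p.
           F (x, p) = (\<Sum>k\<in>UNIV. \<Sum>l\<in>UNIV. u x $ k $ l * p $ k * p $ l)) \<and>
        (\<forall>z\<in>V \<times> UNIV. poisson_bracket (geodesic_hamiltonian g) F z = 0) \<and>
        (\<forall>z. z \<notin> V \<times> UNIV \<longrightarrow> F z = 0)}"

definition fun_scale :: "real \<Rightarrow> ('a \<Rightarrow> real) \<Rightarrow> 'a \<Rightarrow> real"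
  where "fun_scale c f = (\<lambda>z. c * f z)"

global_interpretation fun_space: vector_space "fun_scale :: real \<Rightarrow> ('a \<Rightarrow> real) \<Rightarrow> 'a \<Rightarrow> real"
  by unfold_locales (auto simp: fun_scale_def fun_eq_iff algebra_simps)

text \<open>The library dimension of an infinite-dimensional space is \<open>0\<close>, hence the first conjunct.\<close>

definition quadratic_integrals_dim ::
    "(real^'n::finite) set \<Rightarrow> (real^'n \<Rightarrow> real^'n^'n) \<Rightarrow> nat \<Rightarrow> bool"
  where "quadratic_integrals_dim V g d \<longleftrightarrow>
    (\<exists>B. finite B \<and> quadratic_integrals V g \<subseteq> fun_space.span B) \<and>
    fun_space.dim (quadratic_integrals V g) = d"

text \<open>The dimension near a point: its value on all sufficiently small connected open
  neighbourhoods. (Restricting to a smaller connected set is injective on quadratic integrals but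
  may increase their dimension, so the dimension on a fixed domain is not a local notion.)\<close>

definition local_dim_at :: "(real^'n::finite \<Rightarrow> real^'n^'n) \<Rightarrow> real^'n \<Rightarrow> nat \<Rightarrow> bool"
  where "local_dim_at g x d \<longleftrightarrow>
    (\<exists>W. open W \<and> x \<in> W \<and>
      (\<forall>V. open V \<and> connected V \<and> x \<in> V \<and> V \<subseteq> W \<longrightarrow> quadratic_integrals_dim V g d))"

text \<open>The values of the dimension near regular points, a point being regular if the local dimension
  is constant in a neighbourhood of it.\<close>

definition attained_dims :: "'n::finite itself \<Rightarrow> nat set"
  where "attained_dims _ =
    {d. \<exists>U (g :: real^'n \<Rightarrow> real^'n^'n) x0.
          open U \<and> x0 \<in> U \<and> riemannian_metric_on U g \<and>
          (\<forall>\<^sub>F x in nhds x0. local_dim_at g x d)}"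

definition max_dim :: "nat \<Rightarrow> real"
  where "max_dim n = (real n + 1)^2 * ((real n + 1)^2 - 1) / 12"

definition submax_dim :: "'n::finite itself \<Rightarrow> nat"
  where "submax_dim T = Max {d \<in> attained_dims T. real d < max_dim CARD('n)}"

lemma finite_submaximal_dims: "finite {d \<in> attained_dims T. real d < max_dim m}"
proof (rule finite_subset)
  show "{d \<in> attained_dims T. real d < max_dim m} \<subseteq> {..nat \<lceil>max_dim m\<rceil>}"
    by (auto simp: le_nat_iff) linarith
qed simp

end

theory Submission
  imports Defs
begin

text \<open>The metric \<open>g = x\<^sub>a (dx\<^sub>1\<^sup>2 + \<dots> + dx\<^sub>n\<^sup>2)\<close> on \<open>x\<^sub>a > 0\<close>, the Staeckel transform of a flat
  Hamiltonian with a linear potential, has exactly \<open>n(n+1)/2 + n\<^sup>2(n\<^sup>2-1)/12\<close> independent quadratic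
  integrals on every connected open set, which is \<open>n(n+1)(n-1)/3\<close> below the maximum.
  If \<open>u\<close> is the coefficient matrix of an integral, the equations involving only \<open>u\<^sub>a\<^sub>a\<close>, \<open>u\<^sub>a\<^sub>j\<close>, \<open>u\<^sub>j\<^sub>j\<close>
  form an overdetermined planar system that forces \<open>u\<^sub>a\<^sub>j = - \<partial>\<^sub>j f\<close> for \<open>f = x\<^sub>a u\<^sub>a\<^sub>a\<close>. Then \<open>f\<close> is a
  polynomial of degree at most 2 in the coordinates other than \<open>x\<^sub>a\<close>, and what remains of \<open>u\<close> is
  a Killing tensor of flat \<open>(n-1)\<close>-space. The latter is a quadratic form in the Killing fields
  \<open>L\<^sub>i\<^sub>j = Y\<^sub>i q\<^sub>j - Y\<^sub>j q\<^sub>i\<close>, and the standard monomials in these form a basis modulo the Pluecker relations.\<close>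

section \<open>Calculus of smooth functions\<close>

text \<open>A value counts for \<open>submax_dim\<close> only if it is the local dimension near some
  point and lies strictly below the maximum. Exhibiting many independent integrals settles neither,
  so an exact count is needed, and the upper bound carries most of the work. The integrals come from
  free fall. On the level \<open>H = E\<close> the geodesics are, up to the change of time
  \<open>d\<tau> = dt / x\<^sub>a\<close>, the zero-energy trajectories of
  \<open>p\<^sup>2/2 - E x\<^sub>a\<close>: the other coordinates move uniformly,
  \<open>p\<^sub>a\<close> is linear and \<open>x\<^sub>a\<close> quadratic in \<tau>. The uniform
  motion alone contributes the Killing tensors of flat \<open>(n-1)\<close>-space; their dimension
  \<open>n\<^sup>2(n\<^sup>2-1)/12\<close> is the maximal one with \<open>n - 1\<close> in place of
  \<open>n\<close>. Eliminating \<tau> between uniform motion and fall gives one further integral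
  for each of the \<open>n(n+1)/2\<close> quadratic monomials in \<open>Y\<close>, that is, for a
  basis of the possible polynomials \<open>f\<close>.\<close>

lemma frechet_derivative_cong_open:
  assumes "open S" "x \<in> S" "\<And>y. y \<in> S \<Longrightarrow> f y = g y"
  shows "frechet_derivative f (at x) = frechet_derivative g (at x)"
proof -
  have "(f has_derivative D) (at x) \<longleftrightarrow> (g has_derivative D) (at x)" for D
    using has_derivative_transform_within_open[OF _ assms(1,2), of f D UNIV g]
      has_derivative_transform_within_open[OF _ assms(1,2), of g D UNIV f] assms(3) by auto
  then show ?thesis by (simp add: frechet_derivative_def)
qed

lemma differentiable_cong_open:
  assumes "open S" "x \<in> S" "\<And>y. y \<in> S \<Longrightarrow> f y = g y" "f differentiable (at x)"
  shows "g differentiable (at x)"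
  using assms has_derivative_transform_within_open[OF _ assms(1,2), of f _ UNIV g]
  unfolding differentiable_def by metis

lemma Ck_on_cong:
  assumes "open S" "\<And>y. y \<in> S \<Longrightarrow> f y = g y" "Ck_on k S f"
  shows "Ck_on k S g"
  using assms(2,3)
proof (induction k arbitrary: f g)
  case 0 then show ?case using continuous_on_cong[of S S f g] by simp
next
  case (Suc k)
  have "Ck_on k S (\<lambda>x. frechet_derivative g (at x) v)" for v
    using Suc.IH[of "\<lambda>x. frechet_derivative f (at x) v" "\<lambda>x. frechet_derivative g (at x) v"] Suc.prems
      frechet_derivative_cong_open[OF assms(1), of _ f g] by simp
  moreover have "g differentiable (at x)" if "x \<in> S" for x
    using differentiable_cong_open[OF assms(1) that, of f g] Suc.prems that by simp
  ultimately show ?case by simp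
qed

lemma Ck_on_Suc_imp: "Ck_on (Suc k) S f \<Longrightarrow> Ck_on k S f"
proof (induction k arbitrary: f)
  case 0 then show ?case
    by (auto intro!: differentiable_imp_continuous_on
        simp: differentiable_on_def differentiable_at_withinI)
qed auto

lemma Ck_on_const: "Ck_on k S (\<lambda>x. c)"
  by (induction k arbitrary: c) (auto simp: frechet_derivative_const)

lemma Ck_on_bounded_linear:
  assumes "bounded_linear f" shows "Ck_on k S f"
proof (cases k)
  case 0 then show ?thesis using assms by (simp add: linear_continuous_on)
next
  case (Suc m)
  have "frechet_derivative f (at x) = f" for x
    using frechet_derivative_at[OF bounded_linear_imp_has_derivative[OF assms]] by simp
  then show ?thesis using Suc assms bounded_linear_imp_differentiable
    by (auto simp: Ck_on_const)
qed

lemma Ck_on_add: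
  assumes "open S" "Ck_on k S f" "Ck_on k S g"
  shows "Ck_on k S (\<lambda>x. f x + g x)"
  using assms(2,3)
proof (induction k arbitrary: f g)
  case 0 then show ?case by (simp add: continuous_on_add)
next
  case (Suc k)
  have "frechet_derivative (\<lambda>x. f x + g x) (at x) v =
      frechet_derivative f (at x) v + frechet_derivative g (at x) v" if "x \<in> S" for x v
  proof -
    have "((\<lambda>x. f x + g x) has_derivative (\<lambda>v. frechet_derivative f (at x) v +
        frechet_derivative g (at x) v)) (at x)"
      using Suc.prems that by (intro has_derivative_add) (auto simp: frechet_derivative_works[symmetric])
    from frechet_derivative_at[OF this, symmetric] show ?thesis by simp
  qed
  then have D: "frechet_derivative f (at x) v + frechet_derivative g (at x) v =
      frechet_derivative (\<lambda>x. f x + g x) (at x) v" if "x \<in> S" for x v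
    using that by simp
  have "Ck_on k S (\<lambda>x. frechet_derivative f (at x) v + frechet_derivative g (at x) v)" for v
    using Suc by simp
  then have "Ck_on k S (\<lambda>x. frechet_derivative (\<lambda>x. f x + g x) (at x) v)" for v
    by (rule Ck_on_cong[OF assms(1) D, rotated])
  then show ?case using Suc.prems by simp
qed

lemma frechet_derivative_mult_real:
  fixes f g :: "'a::real_normed_vector \<Rightarrow> real"
  assumes "f differentiable (at x)" "g differentiable (at x)"
  shows "frechet_derivative (\<lambda>x. f x * g x) (at x) v =
      f x * frechet_derivative g (at x) v + frechet_derivative f (at x) v * g x"
proof -
  have "((\<lambda>x. f x * g x) has_derivative (\<lambda>v. f x * frechet_derivative g (at x) v +
      frechet_derivative f (at x) v * g x)) (at x)"
    using assms by (intro has_derivative_mult) (auto simp: frechet_derivative_works[symmetric])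
  from frechet_derivative_at[OF this, symmetric] show ?thesis by simp
qed

lemma Ck_on_mult:
  fixes f g :: "'a::real_normed_vector \<Rightarrow> real"
  assumes "open S" "Ck_on k S f" "Ck_on k S g"
  shows "Ck_on k S (\<lambda>x. f x * g x)"
  using assms(2,3)
proof (induction k arbitrary: f g)
  case 0 then show ?case by (simp add: continuous_on_mult)
next
  case (Suc k)
  have "Ck_on k S (\<lambda>x. f x * frechet_derivative g (at x) v + frechet_derivative f (at x) v * g x)" for v
    using Suc.prems by (intro Ck_on_add[OF assms(1)] Suc.IH) (auto intro: Ck_on_Suc_imp)
  then have "Ck_on k S (\<lambda>x. frechet_derivative (\<lambda>x. f x * g x) (at x) v)" for v
    by (rule Ck_on_cong[OF assms(1), rotated])
      (use Suc.prems in \<open>simp add: frechet_derivative_mult_real\<close>)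
  then show ?case using Suc.prems by simp
qed

lemma Ck_on_inverse:
  fixes f :: "'a::real_normed_vector \<Rightarrow> real"
  assumes "open S" "\<And>x. x \<in> S \<Longrightarrow> f x \<noteq> 0" "Ck_on k S f"
  shows "Ck_on k S (\<lambda>x. inverse (f x))"
  using assms(3)
proof (induction k)
  case 0 then show ?case using assms(2) by (simp add: continuous_on_inverse)
next
  case (Suc k)
  have D: "((\<lambda>x. inverse (f x)) has_derivative
      (\<lambda>v. - (inverse (f x) * frechet_derivative f (at x) v * inverse (f x)))) (at x)" if "x \<in> S" for x
    using Suc.prems that assms(2)
    by (intro Deriv.has_derivative_inverse) (auto simp: frechet_derivative_works[symmetric])
  have "Ck_on k S (\<lambda>x. (-1) * (inverse (f x) * frechet_derivative f (at x) v * inverse (f x)))" for v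
    using Suc Ck_on_Suc_imp by (intro Ck_on_mult[OF assms(1)] Ck_on_const) auto
  moreover have D': "(-1) * (inverse (f x) * frechet_derivative f (at x) v * inverse (f x)) =
      frechet_derivative (\<lambda>x. inverse (f x)) (at x) v" if "x \<in> S" for x v
    using frechet_derivative_at[OF D[OF that], symmetric] by simp
  ultimately have "Ck_on k S (\<lambda>x. frechet_derivative (\<lambda>x. inverse (f x)) (at x) v)" for v
    using Ck_on_cong[OF assms(1) D'] by simp
  then show ?case using D by (auto simp: differentiable_def)
qed

lemma smooth_on_const: "smooth_on S (\<lambda>x. c)"
  by (simp add: smooth_on_def Ck_on_const)

lemma smooth_on_bounded_linear: "bounded_linear f \<Longrightarrow> smooth_on S f"
  by (simp add: smooth_on_def Ck_on_bounded_linear)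

lemma smooth_on_add:
  "open S \<Longrightarrow> smooth_on S f \<Longrightarrow> smooth_on S g \<Longrightarrow> smooth_on S (\<lambda>x. f x + g x)"
  by (simp add: smooth_on_def Ck_on_add)

lemma smooth_on_mult:
  fixes f g :: "'a::real_normed_vector \<Rightarrow> real"
  shows "open S \<Longrightarrow> smooth_on S f \<Longrightarrow> smooth_on S g \<Longrightarrow> smooth_on S (\<lambda>x. f x * g x)"
  by (simp add: smooth_on_def Ck_on_mult)

lemma smooth_on_minus:
  fixes f g :: "'a::real_normed_vector \<Rightarrow> real"
  assumes "open S" "smooth_on S f" "smooth_on S g" shows "smooth_on S (\<lambda>x. f x - g x)"
  using smooth_on_add[OF assms(1,2) smooth_on_mult[OF assms(1) smooth_on_const[of S "-1"] assms(3)]]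
  by simp

lemma smooth_on_divide:
  fixes f g :: "'a::real_normed_vector \<Rightarrow> real"
  assumes "open S" "smooth_on S f" "smooth_on S g" "\<And>x. x \<in> S \<Longrightarrow> g x \<noteq> 0"
  shows "smooth_on S (\<lambda>x. f x / g x)"
  using assms by (auto simp: smooth_on_def divide_inverse Ck_on_mult Ck_on_inverse)

lemma smooth_on_sum:
  fixes f :: "'i \<Rightarrow> 'a::real_normed_vector \<Rightarrow> real"
  assumes "open S" "\<And>i. i \<in> I \<Longrightarrow> smooth_on S (f i)"
  shows "smooth_on S (\<lambda>x. \<Sum>i\<in>I. f i x)"
  using assms(2) by (induction I rule: infinite_finite_induct)
    (auto intro: smooth_on_const smooth_on_add[OF assms(1)])

lemma smooth_on_cong:
  "open S \<Longrightarrow> (\<And>y. y \<in> S \<Longrightarrow> f y = g y) \<Longrightarrow> smooth_on S f \<Longrightarrow> smooth_on S g"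
  using Ck_on_cong unfolding smooth_on_def by blast

lemma smooth_on_imp_differentiable: "smooth_on S f \<Longrightarrow> x \<in> S \<Longrightarrow> f differentiable (at x)"
  using Ck_on.simps(2)[of 0 S f] unfolding smooth_on_def by blast

lemma smooth_on_imp_continuous_on: "smooth_on S f \<Longrightarrow> continuous_on S f"
  using Ck_on.simps(1)[of S f] unfolding smooth_on_def by blast

section \<open>Directional derivatives and the symmetry of mixed second derivatives\<close>

definition dir_deriv :: "'a::real_normed_vector \<Rightarrow> ('a \<Rightarrow> real) \<Rightarrow> 'a \<Rightarrow> real"
  where "dir_deriv v f x = frechet_derivative f (at x) v"

lemma smooth_on_dir_deriv: "smooth_on S f \<Longrightarrow> smooth_on S (dir_deriv v f)"
  using Ck_on.simps(2)[of _ S f] unfolding smooth_on_def dir_deriv_def by blast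

lemma has_derivative_dir_deriv:
  "smooth_on S f \<Longrightarrow> x \<in> S \<Longrightarrow> (f has_derivative (\<lambda>v. dir_deriv v f x)) (at x)"
  using smooth_on_imp_differentiable frechet_derivative_works unfolding dir_deriv_def by fastforce

lemma dir_deriv_eqI: "(f has_derivative D) (at x) \<Longrightarrow> dir_deriv v f x = D v"
  by (simp add: dir_deriv_def frechet_derivative_at[symmetric])

lemma dir_deriv_cong:
  "open S \<Longrightarrow> x \<in> S \<Longrightarrow> (\<And>y. y \<in> S \<Longrightarrow> f y = g y) \<Longrightarrow> dir_deriv v f x = dir_deriv v g x"
  unfolding dir_deriv_def using frechet_derivative_cong_open by metis

lemma dir_deriv_const: "dir_deriv v (\<lambda>x. c) x = 0"
  by (simp add: dir_deriv_def frechet_derivative_const)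

lemma dir_deriv_add:
  assumes "smooth_on S f" "smooth_on S g" "x \<in> S"
  shows "dir_deriv v (\<lambda>x. f x + g x) x = dir_deriv v f x + dir_deriv v g x"
  using has_derivative_add[OF has_derivative_dir_deriv[OF assms(1,3)] has_derivative_dir_deriv[OF assms(2,3)]]
  by (rule dir_deriv_eqI)

lemma dir_deriv_minus:
  assumes "smooth_on S f" "smooth_on S g" "x \<in> S"
  shows "dir_deriv v (\<lambda>x. f x - g x) x = dir_deriv v f x - dir_deriv v g x"
  using has_derivative_diff[OF has_derivative_dir_deriv[OF assms(1,3)] has_derivative_dir_deriv[OF assms(2,3)]]
  by (rule dir_deriv_eqI)

lemma dir_deriv_mult:
  assumes "smooth_on S f" "smooth_on S g" "x \<in> S"
  shows "dir_deriv v (\<lambda>x. f x * g x) x = f x * dir_deriv v g x + dir_deriv v f x * g x"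
  using has_derivative_mult[OF has_derivative_dir_deriv[OF assms(1,3)] has_derivative_dir_deriv[OF assms(2,3)]]
  by (rule dir_deriv_eqI)

lemma dir_deriv_cmult:
  assumes "smooth_on S f" "x \<in> S"
  shows "dir_deriv v (\<lambda>x. c * f x) x = c * dir_deriv v f x"
  using dir_deriv_mult[OF smooth_on_const assms, of v c] by (simp add: dir_deriv_const)

lemma dir_deriv_uminus:
  assumes "smooth_on S f" "x \<in> S"
  shows "dir_deriv v (\<lambda>x. - f x) x = - dir_deriv v f x"
  using dir_deriv_cmult[OF assms, of v "-1"] by simp

lemma dir_deriv_line:
  assumes "smooth_on S f" "x + t *\<^sub>R v \<in> S"
  shows "((\<lambda>t. f (x + t *\<^sub>R v)) has_real_derivative dir_deriv v f (x + t *\<^sub>R v)) (at t)"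
proof -
  have *: "((\<lambda>t. x + t *\<^sub>R v) has_derivative (\<lambda>s. s *\<^sub>R v)) (at t)"
    by (auto intro!: derivative_eq_intros)
  have F: "(f has_derivative (\<lambda>u. dir_deriv u f (x + t *\<^sub>R v))) (at (x + t *\<^sub>R v))"
    using assms by (rule has_derivative_dir_deriv)
  have "((\<lambda>t. f (x + t *\<^sub>R v)) has_derivative (\<lambda>s. dir_deriv (s *\<^sub>R v) f (x + t *\<^sub>R v))) (at t)"
    using diff_chain_at[OF * F] by (simp add: o_def)
  moreover have "dir_deriv (s *\<^sub>R v) f (x + t *\<^sub>R v) = dir_deriv v f (x + t *\<^sub>R v) * s" for s
    using linear_cmul[OF has_derivative_linear[OF F], of s v] by simp
  ultimately show ?thesis by (simp add: has_field_derivative_def)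
qed

text \<open>Two applications of the mean value theorem, along \<open>v\<close> to the increment in
  \<open>w\<close> and then along \<open>w\<close>. The second difference on the left is symmetric
  in \<open>v\<close> and \<open>w\<close>, the order of differentiation on the right is not; this
  asymmetry is what \<open>dir_deriv_commute\<close> exploits.\<close>

lemma second_difference_mvt:
  assumes S: "smooth_on S f" and h: "0 < h"
    and in_S: "\<And>s t. 0 \<le> s \<Longrightarrow> s \<le> h \<Longrightarrow> 0 \<le> t \<Longrightarrow> t \<le> h \<Longrightarrow> x + s *\<^sub>R v + t *\<^sub>R w \<in> S"
  shows "\<exists>s t. 0 < s \<and> s < h \<and> 0 < t \<and> t < h \<and>
    f (x + h *\<^sub>R v + h *\<^sub>R w) - f (x + h *\<^sub>R v) - f (x + h *\<^sub>R w) + f x =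
      h * h * dir_deriv w (dir_deriv v f) (x + s *\<^sub>R v + t *\<^sub>R w)"
proof -
  define \<phi> where "\<phi> s = f ((x + h *\<^sub>R w) + s *\<^sub>R v) - f (x + s *\<^sub>R v)" for s
  have "(\<phi> has_real_derivative dir_deriv v f ((x + h *\<^sub>R w) + s *\<^sub>R v) - dir_deriv v f (x + s *\<^sub>R v)) (at s)"
    if "0 \<le> s" "s \<le> h" for s
    unfolding \<phi>_def using in_S[of s h] in_S[of s 0] that h
    by (intro DERIV_diff dir_deriv_line[OF S]) (auto simp: algebra_simps)
  from MVT2[OF h this] obtain s where s: "0 < s" "s < h"
    "\<phi> h - \<phi> 0 = (h - 0) * (dir_deriv v f ((x + h *\<^sub>R w) + s *\<^sub>R v) - dir_deriv v f (x + s *\<^sub>R v))"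
    by blast
  have "((\<lambda>t. dir_deriv v f ((x + s *\<^sub>R v) + t *\<^sub>R w)) has_real_derivative
      dir_deriv w (dir_deriv v f) ((x + s *\<^sub>R v) + t *\<^sub>R w)) (at t)" if "0 \<le> t" "t \<le> h" for t
    using in_S[of s t] that s by (intro dir_deriv_line[OF smooth_on_dir_deriv[OF S]]) auto
  from MVT2[OF h this] obtain t where t: "0 < t" "t < h"
    "dir_deriv v f ((x + s *\<^sub>R v) + h *\<^sub>R w) - dir_deriv v f ((x + s *\<^sub>R v) + 0 *\<^sub>R w) =
      (h - 0) * dir_deriv w (dir_deriv v f) ((x + s *\<^sub>R v) + t *\<^sub>R w)"
    by blast
  have "\<phi> h - \<phi> 0 = h * h * dir_deriv w (dir_deriv v f) (x + s *\<^sub>R v + t *\<^sub>R w)"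
    using s t by (simp add: algebra_simps)
  then show ?thesis using s t unfolding \<phi>_def
    by (intro exI[of _ s] exI[of _ t]) (simp add: algebra_simps)
qed

lemma dir_deriv_commute:
  assumes "open S" and S: "smooth_on S f" and x: "x \<in> S"
  shows "dir_deriv v (dir_deriv w f) x = dir_deriv w (dir_deriv v f) x"
proof -
  let ?G = "dir_deriv w (dir_deriv v f)" and ?H = "dir_deriv v (dir_deriv w f)"
  have "\<bar>?G x - ?H x\<bar> \<le> e" if e: "e > 0" for e
  proof -
    have "isCont ?G x" "isCont ?H x"
      using smooth_on_imp_continuous_on[OF smooth_on_dir_deriv[OF smooth_on_dir_deriv[OF S]]] assms
      by (auto simp: continuous_on_eq_continuous_at)
    then have "\<exists>d>0. \<forall>y. dist y x < d \<longrightarrow> dist (?G y) (?G x) < e/2"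
        "\<exists>d>0. \<forall>y. dist y x < d \<longrightarrow> dist (?H y) (?H x) < e/2"
      unfolding continuous_at_eps_delta using half_gt_zero[OF e] by blast+
    then obtain d1 d2 where d: "d1 > 0" "d2 > 0" "\<And>y. dist y x < d1 \<Longrightarrow> dist (?G y) (?G x) < e/2"
        "\<And>y. dist y x < d2 \<Longrightarrow> dist (?H y) (?H x) < e/2"
      by blast
    obtain d3 where d3: "d3 > 0" "ball x d3 \<subseteq> S" using assms openE by blast
    define r where "r = min (min d1 d2) d3"
    \<comment> \<open>Every point of the parallelogram with sides \<open>h v\<close> and
      \<open>h w\<close> at \<open>x\<close> is then closer to \<open>x\<close> than
      \<open>r\<close>. The summand 1 keeps the denominator positive when both vectors
      vanish.\<close>
    define h where "h = r / (2 * (norm v + norm w + 1))"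
    have r: "r > 0" using d d3 by (simp add: r_def)
    have pos: "norm v + norm w + 1 > 0" using norm_ge_zero[of v] norm_ge_zero[of w] by linarith
    have h: "h > 0" unfolding h_def using r pos by simp
    have near: "dist (x + s *\<^sub>R v + t *\<^sub>R w) x < r" if "0 \<le> s" "s \<le> h" "0 \<le> t" "t \<le> h" for s t
    proof -
      have "norm (s *\<^sub>R v + t *\<^sub>R w) \<le> s * norm v + t * norm w"
        using norm_triangle_ineq[of "s *\<^sub>R v" "t *\<^sub>R w"] that by simp
      also have "\<dots> \<le> h * norm v + h * norm w" using that by (intro add_mono mult_right_mono) auto
      also have "\<dots> < 2 * (h * (norm v + norm w + 1))"
        using h mult_nonneg_nonneg[OF less_imp_le[OF h] norm_ge_zero[of v]]
          mult_nonneg_nonneg[OF less_imp_le[OF h] norm_ge_zero[of w]]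
        unfolding distrib_left by linarith
      also have "\<dots> = r" using pos unfolding h_def by (simp add: field_simps)
      finally show ?thesis by (simp add: dist_norm add.assoc)
    qed
    have near': "dist (x + s *\<^sub>R w + t *\<^sub>R v) x < r" if "0 \<le> s" "s \<le> h" "0 \<le> t" "t \<le> h" for s t
      using near[of t s] that by (simp add: algebra_simps)
    have inS: "x + s *\<^sub>R v + t *\<^sub>R w \<in> S" if "0 \<le> s" "s \<le> h" "0 \<le> t" "t \<le> h" for s t
      using near[OF that] d3 by (auto simp: r_def dist_commute)
    have inS': "x + s *\<^sub>R w + t *\<^sub>R v \<in> S" if "0 \<le> s" "s \<le> h" "0 \<le> t" "t \<le> h" for s t
      using inS[of t s] that by (simp add: algebra_simps)
    obtain s t where st: "0 < s" "s < h" "0 < t" "t < h"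
      "f (x + h *\<^sub>R v + h *\<^sub>R w) - f (x + h *\<^sub>R v) - f (x + h *\<^sub>R w) + f x =
        h * h * ?G (x + s *\<^sub>R v + t *\<^sub>R w)"
      using second_difference_mvt[OF S h inS] by blast
    obtain s' t' where st': "0 < s'" "s' < h" "0 < t'" "t' < h"
      "f (x + h *\<^sub>R w + h *\<^sub>R v) - f (x + h *\<^sub>R w) - f (x + h *\<^sub>R v) + f x =
        h * h * ?H (x + s' *\<^sub>R w + t' *\<^sub>R v)"
      using second_difference_mvt[OF S h inS'] by blast
    \<comment> \<open>One second difference, evaluated in both orders: the two mixed derivatives
      agree at two points near \<open>x\<close>, and continuity carries this to \<open>x\<close> up
      to \<open>e\<close>.\<close>
    have "h * h * ?G (x + s *\<^sub>R v + t *\<^sub>R w) = h * h * ?H (x + s' *\<^sub>R w + t' *\<^sub>R v)"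
      using st(5) st'(5) by (simp add: algebra_simps)
    then have "?G (x + s *\<^sub>R v + t *\<^sub>R w) = ?H (x + s' *\<^sub>R w + t' *\<^sub>R v)" using h by simp
    moreover have "dist (?G (x + s *\<^sub>R v + t *\<^sub>R w)) (?G x) < e/2"
      using near[of s t] st by (intro d(3)) (simp add: r_def)
    moreover have "dist (?H (x + s' *\<^sub>R w + t' *\<^sub>R v)) (?H x) < e/2"
      using near'[of s' t'] st' by (intro d(4)) (simp add: r_def)
    ultimately show ?thesis unfolding dist_real_def by linarith
  qed
  then have "\<bar>?G x - ?H x\<bar> \<le> 0" using field_le_epsilon[of "\<bar>?G x - ?H x\<bar>" 0] by simp
  then show ?thesis by simp
qed

section \<open>The metric and its integrals\<close>

definition affine_metric :: "'n::finite \<Rightarrow> real^'n \<Rightarrow> real^'n^'n"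
  where "affine_metric a x = x $ a *\<^sub>R mat 1"

text \<open>For \<open>Y = hom_coord a x\<close> and \<open>q = mom_coord a p\<close> the functions \<open>Y\<^sub>i q\<^sub>j - Y\<^sub>j q\<^sub>i\<close> are the Killing
  fields of the flat space of the coordinates other than \<open>x\<^sub>a\<close>: translations if \<open>i = a\<close> or \<open>j = a\<close>,
  rotations otherwise.\<close>

definition hom_coord :: "'n::finite \<Rightarrow> real^'n \<Rightarrow> 'n \<Rightarrow> real"
  where "hom_coord a x i = (if i = a then 1 else x $ i)"

definition mom_coord :: "'n::finite \<Rightarrow> real^'n \<Rightarrow> 'n \<Rightarrow> real"
  where "mom_coord a p i = (if i = a then 0 else p $ i)"

definition killing_field :: "'n::finite \<Rightarrow> 'n \<Rightarrow> 'n \<Rightarrow> (real^'n) \<times> (real^'n) \<Rightarrow> real"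
  where "killing_field a i j z = hom_coord a (fst z) i * mom_coord a (snd z) j - hom_coord a (fst z) j * mom_coord a (snd z) i"

definition killing_product :: "'n::finite \<Rightarrow> 'n \<Rightarrow> 'n \<Rightarrow> 'n \<Rightarrow> 'n \<Rightarrow> (real^'n) \<times> (real^'n) \<Rightarrow> real"
  where "killing_product a i j k l z = killing_field a i j z * killing_field a k l z"

definition energy :: "'n::finite \<Rightarrow> (real^'n) \<times> (real^'n) \<Rightarrow> real"
  where "energy a z = (snd z \<bullet> snd z) / fst z $ a"

text \<open>The integral whose coefficient matrix has \<open>x\<^sub>a u\<^sub>a\<^sub>a = Y\<^sub>i Y\<^sub>j\<close> and no flat Killing part.\<close>

definition stackel_integral :: "'n::finite \<Rightarrow> 'n \<Rightarrow> 'n \<Rightarrow> (real^'n) \<times> (real^'n) \<Rightarrow> real"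
  where "stackel_integral a i j z =
    hom_coord a (fst z) i * hom_coord a (fst z) j * energy a z
    - 2 * snd z $ a * (mom_coord a (snd z) i * hom_coord a (fst z) j + hom_coord a (fst z) i * mom_coord a (snd z) j)
    + 4 * fst z $ a * mom_coord a (snd z) i * mom_coord a (snd z) j"

text \<open>Members of \<open>quadratic_integrals\<close> vanish off \<open>V \<times> UNIV\<close>,
  whereas the explicit formulas are nonzero there as total functions; truncation makes the two
  comparable.\<close>

definition extend_zero :: "(real^'n::finite) set \<Rightarrow> ((real^'n) \<times> (real^'n) \<Rightarrow> real) \<Rightarrow> (real^'n) \<times> (real^'n) \<Rightarrow> real"
  where "extend_zero V F z = (if fst z \<in> V then F z else 0)"

section \<open>The Hamiltonian of the metric and its flow\<close>

lemma matrix_inv_eqI: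
  fixes A B :: "real^'n^'n"
  assumes "A ** B = mat 1" "B ** A = mat 1"
  shows "matrix_inv A = B"
proof -
  have "A ** matrix_inv A = mat 1 \<and> matrix_inv A ** A = mat 1"
    unfolding matrix_inv_def by (rule someI[of _ B]) (simp add: assms)
  then show ?thesis
    using assms by (metis matrix_mul_assoc matrix_mul_lid matrix_mul_rid)
qed

lemma matrix_inv_affine_metric:
  assumes "x $ a \<noteq> 0"
  shows "matrix_inv (affine_metric a x) = (1 / x $ a) *\<^sub>R mat 1"
proof -
  have "affine_metric a x ** ((1 / x $ a) *\<^sub>R mat 1) = mat 1"
    "((1 / x $ a) *\<^sub>R mat 1) ** affine_metric a x = mat 1"
    using assms by (simp_all add: affine_metric_def matrix_scalar_ac scalar_matrix_assoc[symmetric])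
  then show ?thesis by (rule matrix_inv_eqI)
qed

lemma geodesic_hamiltonian_affine_metric:
  assumes "fst z $ a \<noteq> 0"
  shows "geodesic_hamiltonian (affine_metric a) z = (snd z \<bullet> snd z) / (2 * fst z $ a)"
proof -
  obtain x p where z: "z = (x, p)" by (cases z)
  have "(\<Sum>i\<in>UNIV. \<Sum>j\<in>UNIV. matrix_inv (affine_metric a x) $ i $ j * p $ i * p $ j) =
      (\<Sum>i\<in>UNIV. \<Sum>j\<in>UNIV. if i = j then (p $ i * p $ i) / x $ a else 0)"
    using assms z by (intro sum.cong refl) (auto simp: matrix_inv_affine_metric mat_def)
  also have "\<dots> = (p \<bullet> p) / x $ a"
    by (simp add: inner_vec_def sum_divide_distrib)
  finally show ?thesis using z by (simp add: geodesic_hamiltonian_def)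
qed

text \<open>The Hamiltonian vector field of the geodesic flow, which makes \<open>{H, \<cdot>}\<close> a directional derivative.\<close>

definition geodesic_field :: "'n::finite \<Rightarrow> (real^'n) \<times> (real^'n) \<Rightarrow> (real^'n) \<times> (real^'n)"
  where "geodesic_field a z = ((1 / fst z $ a) *\<^sub>R snd z, ((snd z \<bullet> snd z) / (2 * (fst z $ a)^2)) *\<^sub>R axis a 1)"

lemma has_derivative_energy:
  fixes z :: "(real^'n::finite) \<times> (real^'n)"
  assumes "fst z $ a \<noteq> 0"
  shows "((\<lambda>z. (snd z \<bullet> snd z) / (2 * fst z $ a)) has_derivative
    (\<lambda>v. (snd z \<bullet> snd v) / fst z $ a - (snd z \<bullet> snd z) * fst v $ a / (2 * (fst z $ a)^2))) (at z)"
  using assms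
  by (auto intro!: derivative_eq_intros bounded_linear.has_derivative[OF bounded_linear_vec_nth]
      simp: inner_commute field_simps power2_eq_square)

text \<open>With the sign convention of \<open>poisson_bracket\<close>, bracketing with the
  Hamiltonian is minus differentiation along its vector field. Linearity of the derivative of
  \<open>F\<close> collects the sum over coordinates into one direction.\<close>

lemma poisson_bracket_affine_metric:
  fixes V :: "(real^'n::finite) set"
  assumes V: "open V" "V \<subseteq> {x. 0 < x $ a}" "x \<in> V"
    and F: "F differentiable (at (x, p))"
  shows "poisson_bracket (geodesic_hamiltonian (affine_metric a)) F (x, p) = - dir_deriv (geodesic_field a (x, p)) F (x, p)"
proof -
  let ?z = "(x, p)" and ?D = "frechet_derivative F (at (x, p))"
  have xa: "x $ a > 0" using V by auto
  \<comment> \<open>The closed form of the Hamiltonian is valid only where \<open>x\<^sub>a\<close>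
    is nonzero, so the derivatives are compared on the open set
    \<open>V \<times> UNIV\<close>.\<close>
  have H: "frechet_derivative (geodesic_hamiltonian (affine_metric a)) (at ?z) v =
      (p \<bullet> snd v) / x $ a - (p \<bullet> p) * fst v $ a / (2 * (x $ a)^2)" for v
  proof -
    have "frechet_derivative (geodesic_hamiltonian (affine_metric a)) (at ?z) =
        frechet_derivative (\<lambda>z. (snd z \<bullet> snd z) / (2 * fst z $ a)) (at ?z)"
      using V by (intro frechet_derivative_cong_open[of "V \<times> UNIV"])
        (auto intro!: open_Times geodesic_hamiltonian_affine_metric)
    then show ?thesis
      using frechet_derivative_at[OF has_derivative_energy[of ?z a], symmetric] xa by simp
  qed
  have lin: "linear ?D" using F by (rule linear_frechet_derivative)
  have "poisson_bracket (geodesic_hamiltonian (affine_metric a)) F ?z =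
      (\<Sum>i\<in>UNIV. - (p \<bullet> p) * (axis i 1 $ a) / (2 * (x $ a)^2) * ?D (0, axis i 1)
        - (p $ i) / x $ a * ?D (axis i 1, 0))"
    unfolding poisson_bracket_def H by (simp add: inner_axis)
  also have "\<dots> = - (\<Sum>i\<in>UNIV. ?D (((p $ i) / x $ a) *\<^sub>R (axis i 1, 0)
      + ((p \<bullet> p) * (axis i 1 $ a) / (2 * (x $ a)^2)) *\<^sub>R (0, axis i 1)))"
    unfolding sum_negf[symmetric]
    by (intro sum.cong refl) (simp only: linear_add[OF lin] linear_cmul[OF lin], simp)
  also have "\<dots> = - ?D (\<Sum>i\<in>UNIV. ((p $ i) / x $ a) *\<^sub>R (axis i 1, 0)
      + ((p \<bullet> p) * (axis i 1 $ a) / (2 * (x $ a)^2)) *\<^sub>R (0, axis i 1))"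
    by (simp only: linear_sum[OF lin])
  also have "(\<Sum>i\<in>UNIV. ((p $ i) / x $ a) *\<^sub>R (axis i 1, 0)
      + ((p \<bullet> p) * (axis i 1 $ a) / (2 * (x $ a)^2)) *\<^sub>R (0, axis i 1 :: real^'n)) = geodesic_field a ?z"
    unfolding geodesic_field_def
    by (auto simp: prod_eq_iff vec_eq_iff fst_sum snd_sum sum_component axis_def if_distrib sum.If_cases
        cong: if_cong)
  finally show ?thesis by (simp add: dir_deriv_def)
qed

lemma smooth_on_fst_nth: "smooth_on S (\<lambda>z::(real^'n::finite) \<times> (real^'n). fst z $ i)"
  by (intro smooth_on_bounded_linear bounded_linear_compose[OF bounded_linear_vec_nth] bounded_linear_fst)

lemma smooth_on_snd_nth: "smooth_on S (\<lambda>z::(real^'n::finite) \<times> (real^'n). snd z $ i)"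
  by (intro smooth_on_bounded_linear bounded_linear_compose[OF bounded_linear_vec_nth] bounded_linear_snd)

lemma smooth_on_hom_coord: "smooth_on S (\<lambda>z::(real^'n::finite) \<times> (real^'n). hom_coord a (fst z) i)"
  by (cases "i = a") (simp_all add: hom_coord_def smooth_on_const smooth_on_fst_nth)

lemma smooth_on_mom_coord: "smooth_on S (\<lambda>z::(real^'n::finite) \<times> (real^'n). mom_coord a (snd z) i)"
  by (cases "i = a") (simp_all add: mom_coord_def smooth_on_const smooth_on_snd_nth)

lemma smooth_on_energy:
  fixes a :: "'n::finite"
  assumes "open S" "S \<subseteq> {z. 0 < fst z $ a}"
  shows "smooth_on S (energy a)"
  unfolding energy_def[abs_def] inner_vec_def inner_real_def using assms
  by (intro smooth_on_divide smooth_on_sum smooth_on_mult smooth_on_fst_nth smooth_on_snd_nth) auto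

lemmas smooth_on_intros = smooth_on_add smooth_on_minus smooth_on_mult smooth_on_const
  smooth_on_hom_coord smooth_on_mom_coord smooth_on_fst_nth smooth_on_snd_nth

lemma dir_deriv_bounded_linear: "bounded_linear f \<Longrightarrow> dir_deriv v f x = f v"
  by (rule dir_deriv_eqI) (rule bounded_linear_imp_has_derivative)

lemma dir_deriv_fst_nth: "dir_deriv v (\<lambda>z::(real^'n::finite) \<times> (real^'n). fst z $ i) z = fst v $ i"
  by (intro dir_deriv_bounded_linear bounded_linear_compose[OF bounded_linear_vec_nth] bounded_linear_fst)

lemma dir_deriv_snd_nth: "dir_deriv v (\<lambda>z::(real^'n::finite) \<times> (real^'n). snd z $ i) z = snd v $ i"
  by (intro dir_deriv_bounded_linear bounded_linear_compose[OF bounded_linear_vec_nth] bounded_linear_snd)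

text \<open>In the time \<tau> with \<open>d\<tau> = dt / x\<^sub>a\<close> the
  \<open>Y\<^sub>i\<close> move with velocity \<open>q\<^sub>i\<close>, which is constant by the
  next lemma. For \<open>i = a\<close> both sides vanish, so the homogenizing coordinate needs no
  separate treatment.\<close>

lemma dir_deriv_geodesic_field_hom_coord: "dir_deriv (geodesic_field a z) (\<lambda>z. hom_coord a (fst z) i) z = mom_coord a (snd z) i / fst z $ a"
  by (cases "i = a") (simp_all add: hom_coord_def mom_coord_def dir_deriv_const dir_deriv_fst_nth geodesic_field_def)

lemma dir_deriv_geodesic_field_mom_coord: "dir_deriv (geodesic_field a z) (\<lambda>z. mom_coord a (snd z) i) z = 0"
  by (cases "i = a") (simp_all add: mom_coord_def dir_deriv_const dir_deriv_snd_nth geodesic_field_def axis_def)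

lemma dir_deriv_geodesic_field_energy:
  assumes "fst z $ a \<noteq> 0"
  shows "dir_deriv (geodesic_field a z) (energy a) z = 0"
proof -
  have "((\<lambda>z. 2 * ((snd z \<bullet> snd z) / (2 * fst z $ a))) has_derivative
    (\<lambda>v. 2 * ((snd z \<bullet> snd v) / fst z $ a - (snd z \<bullet> snd z) * fst v $ a / (2 * (fst z $ a)^2)))) (at z)"
    by (intro has_derivative_mult_right has_derivative_energy assms)
  from dir_deriv_eqI[OF this, of "geodesic_field a z"] show ?thesis using assms
    by (simp add: energy_def[abs_def] geodesic_field_def inner_axis field_simps power2_eq_square)
qed

section \<open>Verification that the explicit functions are integrals\<close>

lemma bilinear_form_expansion:
  fixes B :: "real^'n::finite \<Rightarrow> real^'n \<Rightarrow> real"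
  assumes "bilinear B"
  shows "B p q = (\<Sum>k\<in>UNIV. \<Sum>l\<in>UNIV. B (axis k 1) (axis l 1) * p $ k * q $ l)"
proof -
  have "B p q = B (\<Sum>k\<in>UNIV. p $ k *\<^sub>R axis k 1) (\<Sum>l\<in>UNIV. q $ l *\<^sub>R axis l 1)"
    using basis_expansion[of p] basis_expansion[of q] by (simp add: scalar_mult_eq_scaleR)
  also have "\<dots> = (\<Sum>(k,l)\<in>UNIV \<times> UNIV. B (p $ k *\<^sub>R axis k 1) (q $ l *\<^sub>R axis l 1))"
    by (rule bilinear_sum[OF assms])
  also have "\<dots> = (\<Sum>k\<in>UNIV. \<Sum>l\<in>UNIV. B (axis k 1) (axis l 1) * p $ k * q $ l)"
    unfolding sum.cartesian_product[symmetric]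
    by (intro sum.cong refl) (simp add: bilinear_lmul[OF assms] bilinear_rmul[OF assms])
  finally show ?thesis .
qed

text \<open>The coefficient matrix demanded by \<open>quadratic_integrals\<close> is read off from
  \<open>B x\<close> on basis vectors. \<open>B x\<close> may be nonsymmetric, so products of linear
  forms in the momenta can be used as they stand.\<close>

lemma extend_zero_mem_quadratic_integrals:
  fixes V :: "(real^'n::finite) set"
  assumes V: "open V" "V \<subseteq> {x. 0 < x $ a}"
    and S: "smooth_on (V \<times> UNIV) F"
    and B: "\<And>x. x \<in> V \<Longrightarrow> bilinear (B x)" "\<And>x p. x \<in> V \<Longrightarrow> F (x, p) = B x p p"
    and D: "\<And>z. fst z \<in> V \<Longrightarrow> dir_deriv (geodesic_field a z) F z = 0"
  shows "extend_zero V F \<in> quadratic_integrals V (affine_metric a)"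
proof -
  have oV: "open (V \<times> (UNIV :: (real^'n) set))" using V by (simp add: open_Times)
  have S': "smooth_on (V \<times> UNIV) (extend_zero V F)"
    by (rule smooth_on_cong[OF oV _ S]) (auto simp: extend_zero_def)
  have "extend_zero V F (x, p) = (\<Sum>k\<in>UNIV. \<Sum>l\<in>UNIV. (\<chi> k l. B x (axis k 1) (axis l 1)) $ k $ l * p $ k * p $ l)"
    if "x \<in> V" for x p
    using bilinear_form_expansion[OF B(1)[OF that], of p p] B(2)[OF that] that by (simp add: extend_zero_def)
  then have "\<exists>u :: real^'n \<Rightarrow> real^'n^'n. \<forall>x\<in>V. \<forall>p.
      extend_zero V F (x, p) = (\<Sum>k\<in>UNIV. \<Sum>l\<in>UNIV. u x $ k $ l * p $ k * p $ l)"
    by (intro exI[of _ "\<lambda>x. \<chi> k l. B x (axis k 1) (axis l 1)"]) blast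
  moreover have "poisson_bracket (geodesic_hamiltonian (affine_metric a)) (extend_zero V F) z = 0"
    if "z \<in> V \<times> UNIV" for z
  proof -
    from that obtain x p where z: "z = (x, p)" "x \<in> V" by (cases z) auto
    have "dir_deriv (geodesic_field a z) (extend_zero V F) z = dir_deriv (geodesic_field a z) F z"
      by (rule dir_deriv_cong[OF oV that]) (auto simp: extend_zero_def)
    then show ?thesis
      using poisson_bracket_affine_metric[OF V z(2) smooth_on_imp_differentiable[OF S', of "(x,p)"]] z D[of z]
      by simp
  qed
  ultimately show ?thesis using S' by (auto simp: quadratic_integrals_def extend_zero_def)
qed

lemma mom_coord_add: "mom_coord a (p + q) i = mom_coord a p i + mom_coord a q i"
  and mom_coord_scaleR: "mom_coord a (c *\<^sub>R p) i = c * mom_coord a p i"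
  by (simp_all add: mom_coord_def)

text \<open>Each factor is itself a linear integral: \<open>Y\<close> has velocity proportional to
  \<open>q\<close> and \<open>q\<close> is constant, so the derivative of the minor
  \<open>Y\<^sub>i q\<^sub>j - Y\<^sub>j q\<^sub>i\<close> is a minor with two proportional
  rows.\<close>

lemma killing_product_mem:
  fixes V :: "(real^'n::finite) set"
  assumes V: "open V" "V \<subseteq> {x. 0 < x $ a}"
  shows "extend_zero V (killing_product a i j k l) \<in> quadratic_integrals V (affine_metric a)"
proof (rule extend_zero_mem_quadratic_integrals[OF V])
  have oV: "open (V \<times> (UNIV :: (real^'n) set))" using V by (simp add: open_Times)
  have S: "smooth_on (V \<times> UNIV) (killing_field a i j)" for i j
    unfolding killing_field_def[abs_def] using oV by (intro smooth_on_intros)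
  then show "smooth_on (V \<times> UNIV) (killing_product a i j k l)"
    unfolding killing_product_def[abs_def] using oV by (intro smooth_on_mult)
  let ?B = "\<lambda>x p q. killing_field a i j (x, p) * killing_field a k l (x, q)"
  show "bilinear (?B x)" for x
    by (auto simp: bilinear_def linear_iff killing_field_def mom_coord_add mom_coord_scaleR algebra_simps)
  show "killing_product a i j k l (x, p) = ?B x p p" for x p by (simp add: killing_product_def)
  have D: "dir_deriv (geodesic_field a z) (killing_field a i j) z = 0" if "fst z \<in> V" for z i j
  proof -
    have z: "z \<in> V \<times> UNIV" using that by (cases z) auto
    show ?thesis unfolding killing_field_def[abs_def]
      by (simp add: dir_deriv_minus[OF _ _ z] dir_deriv_mult[OF _ _ z] oV smooth_on_intros
          dir_deriv_geodesic_field_hom_coord dir_deriv_geodesic_field_mom_coord)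
  qed
  show "dir_deriv (geodesic_field a z) (killing_product a i j k l) z = 0" if "fst z \<in> V" for z
  proof -
    have z: "z \<in> V \<times> UNIV" using that by (cases z) auto
    show ?thesis unfolding killing_product_def[abs_def]
      using that by (simp add: dir_deriv_mult[OF S S z] D)
  qed
qed

text \<open>In the time \<tau>, with \<open>e\<close> the conserved \<open>energy\<close>, one has
  \<open>Y\<^sub>i' = q\<^sub>i\<close>, \<open>x\<^sub>a' = p\<^sub>a\<close> and
  \<open>p\<^sub>a' = e / 2\<close>. The factor 2 makes the derivative of \<open>p\<^sub>a\<close>
  cancel that of \<open>e Y\<^sub>i Y\<^sub>j\<close>; the remainder
  \<open>- 4 p\<^sub>a q\<^sub>i q\<^sub>j\<close> is cancelled by the term with factor 4.\<close>

lemma stackel_integral_mem: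
  fixes V :: "(real^'n::finite) set"
  assumes V: "open V" "V \<subseteq> {x. 0 < x $ a}"
  shows "extend_zero V (stackel_integral a i j) \<in> quadratic_integrals V (affine_metric a)"
proof (rule extend_zero_mem_quadratic_integrals[OF V])
  have oV: "open (V \<times> (UNIV :: (real^'n) set))" using V by (simp add: open_Times)
  have E: "smooth_on (V \<times> UNIV) (energy a)"
    using V by (intro smooth_on_energy oV) auto
  show "smooth_on (V \<times> UNIV) (stackel_integral a i j)"
    unfolding stackel_integral_def[abs_def] using oV E by (intro smooth_on_intros)
  let ?B = "\<lambda>x p q. hom_coord a x i * hom_coord a x j * ((p \<bullet> q) / x $ a)
    - 2 * p $ a * (mom_coord a q i * hom_coord a x j + hom_coord a x i * mom_coord a q j) + 4 * x $ a * mom_coord a p i * mom_coord a q j"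
  show "bilinear (?B x)" for x
    by (auto simp: bilinear_def linear_iff mom_coord_add mom_coord_scaleR inner_add_left inner_add_right
        algebra_simps add_divide_distrib)
  show "stackel_integral a i j (x, p) = ?B x p p" for x p by (simp add: stackel_integral_def energy_def)
  show "dir_deriv (geodesic_field a z) (stackel_integral a i j) z = 0" if "fst z \<in> V" for z
  proof -
    have z: "z \<in> V \<times> UNIV" using that by (cases z) auto
    have za: "fst z $ a \<noteq> 0" using that V by auto
    show ?thesis unfolding stackel_integral_def[abs_def]
      apply (simp del: times_divide_eq_right times_divide_eq_left add: dir_deriv_minus[OF _ _ z] dir_deriv_add[OF _ _ z] dir_deriv_mult[OF _ _ z] oV smooth_on_intros
          E dir_deriv_geodesic_field_hom_coord dir_deriv_geodesic_field_mom_coord dir_deriv_geodesic_field_energy[OF za] dir_deriv_const dir_deriv_fst_nth dir_deriv_snd_nth)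
      using za by (simp add: geodesic_field_def energy_def field_simps power2_eq_square)
  qed
qed

lemma smooth_affine_metric: "smooth_on S (affine_metric a)"
  unfolding affine_metric_def[abs_def]
  by (intro smooth_on_bounded_linear bounded_linear_scaleR_left[THEN bounded_linear_compose]
      bounded_linear_vec_nth)

lemma riemannian_affine_metric: "riemannian_metric_on {x. 0 < x $ a} (affine_metric a)"
  by (auto simp: riemannian_metric_on_def smooth_affine_metric affine_metric_def transpose_scalar
      scaleR_matrix_vector_assoc[symmetric])

section \<open>Counting and independence of standard monomials\<close>

lemma sum_fun_eval: "(\<Sum>s\<in>A. f s) z = (\<Sum>s\<in>A. f s z)"
  for f :: "'s \<Rightarrow> 'a \<Rightarrow> real"
  by (induction A rule: infinite_finite_induct) (simp_all add: zero_fun_def plus_fun_def)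

text \<open>Two equal members at different indices would be annihilated by the coefficients 1 and
  -1, so the same hypothesis yields injectivity. This is what identifies the size of the basis with
  the size of the index set.\<close>

lemma independent_family:
  fixes E :: "'s \<Rightarrow> 'a \<Rightarrow> real"
  assumes fin: "finite J"
    and coeff: "\<And>c. (\<And>z. (\<Sum>s\<in>J. c s * E s z) = 0) \<Longrightarrow> \<forall>s\<in>J. c s = 0"
  shows "inj_on E J" "\<not> fun_space.dependent (E ` J)"
proof -
  show inj: "inj_on E J"
  proof (rule inj_onI, rule ccontr)
    fix s t assume st: "s \<in> J" "t \<in> J" "E s = E t" "s \<noteq> t"
    define c where "c u = (if u = s then 1 else if u = t then - 1 else 0 :: real)" for u
    have "(\<Sum>u\<in>J. c u * E u z) = 0" for z
    proof -
      have "(\<Sum>u\<in>J. c u * E u z) = (\<Sum>u\<in>{s,t}. c u * E u z)"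
        using st fin by (intro sum.mono_neutral_right) (auto simp: c_def)
      then show ?thesis using st by (simp add: c_def)
    qed
    from coeff[OF this] st show False by (auto simp: c_def)
  qed
  show "\<not> fun_space.dependent (E ` J)"
    unfolding fun_space.independent_explicit_module
  proof (intro allI impI)
    fix t u v assume t: "finite t" "t \<subseteq> E ` J" "(\<Sum>v\<in>t. fun_scale (u v) v) = 0" "v \<in> t"
    define c where "c s = (if E s \<in> t then u (E s) else 0)" for s
    have "(\<Sum>s\<in>J. c s * E s z) = 0" for z
    proof -
      have "(\<Sum>s\<in>J. c s * E s z) = (\<Sum>s\<in>{s\<in>J. E s \<in> t}. u (E s) * E s z)"
        using fin by (intro sum.mono_neutral_cong_right) (auto simp: c_def)
      also have "\<dots> = (\<Sum>f\<in>E ` {s\<in>J. E s \<in> t}. u f * f z)"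
        using inj by (subst sum.reindex) (auto simp: inj_on_def)
      also have "E ` {s\<in>J. E s \<in> t} = t" using t(2) by auto
      also have "(\<Sum>f\<in>t. u f * f z) = (\<Sum>f\<in>t. fun_scale (u f) f) z"
        by (simp add: sum_fun_eval fun_scale_def)
      finally show ?thesis using t(3) by simp
    qed
    moreover obtain s where "s \<in> J" "v = E s" using t(2,4) by blast
    ultimately show "u v = 0" using coeff[of c] t(4) by (auto simp: c_def)
  qed
qed

section \<open>Counting the standard monomials\<close>

lemma sum_of_squares_rev: "6 * (\<Sum>i<n. (n - i) * (n - i)) = n * (n + 1) * (2 * n + 1)" for n :: nat
proof -
  have "(\<Sum>i<n. (n - i) * (n - i)) = (\<Sum>i<n. Suc (n - Suc i) * Suc (n - Suc i))"
    by (intro sum.cong refl) (simp add: Suc_diff_Suc)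
  also have "\<dots> = (\<Sum>i<n. Suc i * Suc i)"
    by (rule sum.nat_diff_reindex[of "\<lambda>i. Suc i * Suc i"])
  also have "6 * \<dots> = n * (n + 1) * (2 * n + 1)"
    by (induction n) (simp_all add: algebra_simps)
  finally show ?thesis .
qed

text \<open>These are the semistandard Young tableaux of shape 2 by 2 with columns
  \<open>(i, j)\<close> and \<open>(k, l)\<close>, which index a basis of the degree 2 part of the
  coordinate ring of the Grassmannian of planes in \<open>n\<close>-space. The index type carries no
  order, so \<open>r\<close> ranks it.\<close>

definition std_quads :: "('n \<Rightarrow> nat) \<Rightarrow> ('n \<times> 'n \<times> 'n \<times> 'n) set"
  where "std_quads r = {(i, j, k, l). r i < r j \<and> r k < r l \<and> r i \<le> r k \<and> r j \<le> r l}"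

definition std_pairs :: "('n \<Rightarrow> nat) \<Rightarrow> ('n \<times> 'n) set"
  where "std_pairs r = {(i, j). r i \<le> r j}"

text \<open>The count \<open>n\<^sup>2(n\<^sup>2-1)/12\<close> in a form without division or
  truncated subtraction. Finiteness takes part in the induction because the cardinality of the
  disjoint union requires it.\<close>

lemma card_std_quads_nat:
  "finite {(i, j, k, l). i < j \<and> k < l \<and> i \<le> k \<and> j \<le> l \<and> l < n} \<and>
    12 * card {(i, j, k, l). i < j \<and> k < l \<and> i \<le> k \<and> j \<le> l \<and> l < n} + n^2 = n^4"
  for n :: nat
proof (induction n)
  case 0 show ?case by simp
next
  case (Suc n)
  let ?A = "\<lambda>n. {(i, j, k, l). i < j \<and> k < l \<and> i \<le> k \<and> j \<le> l \<and> l < (n::nat)}"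
  \<comment> \<open>The new tableaux have \<open>l = n\<close>. For fixed \<open>i\<close>, the
    entries \<open>j\<close> and \<open>k\<close> then range independently over \<open>n - i\<close>
    values each, which leads to a sum of squares.\<close>
  let ?S = "Sigma {..<n} (\<lambda>i. {i<..n} \<times> {i..<n})"
  let ?f = "\<lambda>(i, j, k). (i, j, k, n)"
  have A: "?A (Suc n) = ?A n \<union> ?f ` ?S"
    by (force simp: image_iff less_Suc_eq)
  have "card (?f ` ?S) = card ?S" by (intro card_image) (auto simp: inj_on_def)
  also have "\<dots> = (\<Sum>i<n. (n - i) * (n - i))" by (subst card_SigmaI) (auto simp: card_cartesian_product)
  finally have S: "6 * card (?f ` ?S) = n * (n + 1) * (2 * n + 1)" by (simp only: sum_of_squares_rev)
  have "card (?A (Suc n)) = card (?A n) + card (?f ` ?S)"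
    unfolding A using Suc.IH by (intro card_Un_disjoint) auto
  moreover have "finite (?A (Suc n))" unfolding A using Suc.IH by auto
  moreover have "12 * (card (?A n) + card (?f ` ?S)) + (Suc n)^2 = (Suc n)^4"
  proof -
    have "12 * (card (?A n) + card (?f ` ?S)) + (Suc n)^2 =
        (12 * card (?A n) + n^2) + 2 * (6 * card (?f ` ?S)) + 2 * n + 1"
      by (simp add: power2_eq_square)
    also have "\<dots> = n^4 + 2 * (n * (n + 1) * (2 * n + 1)) + 2 * n + 1"
      using Suc.IH S by simp
    also have "\<dots> = (Suc n)^4" by (simp add: eval_nat_numeral algebra_simps)
    finally show ?thesis .
  qed
  ultimately show ?case by simp
qed

lemma card_std_pairs_nat:
  "finite {(i, j). i \<le> j \<and> j < n} \<and> 2 * card {(i, j). i \<le> j \<and> j < n} = n * (n + 1)" for n :: nat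
proof -
  have "{(i, j). i \<le> j \<and> j < n} = (\<lambda>(j, i). (i, j)) ` Sigma {..<n} (\<lambda>j. {..j})" by auto
  moreover have "card ((\<lambda>(j, i). (i, j)) ` Sigma {..<n} (\<lambda>j. {..j})) = card (Sigma {..<n} (\<lambda>j. {..j}))"
    by (intro card_image) (auto simp: inj_on_def)
  moreover have "2 * (\<Sum>j<n. Suc j) = n * (n + 1)" by (induction n) auto
  ultimately show ?thesis by simp
qed

lemma card_std_quads:
  fixes r :: "'n::finite \<Rightarrow> nat"
  assumes "bij_betw r UNIV {..<CARD('n)}"
  shows "12 * card (std_quads r) + CARD('n)^2 = CARD('n)^4"
proof -
  let ?f = "\<lambda>(i, j, k, l). (r i, r j, r k, r l)"
  have inj: "inj r" and im: "range r = {..<CARD('n)}" using assms by (auto simp: bij_betw_def)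
  have "?f ` std_quads r = {(i, j, k, l). i < j \<and> k < l \<and> i \<le> k \<and> j \<le> l \<and> l < CARD('n)}" (is "_ = ?R")
  proof
    show "?f ` std_quads r \<subseteq> ?R" using im by (auto simp: std_quads_def)
    show "?R \<subseteq> ?f ` std_quads r"
    proof
      fix t assume "t \<in> ?R"
      then obtain i j k l where t: "t = (i, j, k, l)" "i < j" "k < l" "i \<le> k" "j \<le> l" "l < CARD('n)" by auto
      then have "i \<in> range r" "j \<in> range r" "k \<in> range r" "l \<in> range r" using im by auto
      then obtain i' j' k' l' where "i = r i'" "j = r j'" "k = r k'" "l = r l'" by blast
      then show "t \<in> ?f ` std_quads r" using t by (auto simp: std_quads_def image_iff)
    qed
  qed
  moreover have "card (?f ` std_quads r) = card (std_quads r)"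
    using inj by (intro card_image) (auto simp: inj_on_def)
  ultimately show ?thesis using card_std_quads_nat[of "CARD('n)"] by simp
qed

lemma card_std_pairs:
  fixes r :: "'n::finite \<Rightarrow> nat"
  assumes "bij_betw r UNIV {..<CARD('n)}"
  shows "2 * card (std_pairs r) = CARD('n) * (CARD('n) + 1)"
proof -
  let ?f = "\<lambda>(i, j). (r i, r j)"
  have inj: "inj r" and im: "range r = {..<CARD('n)}" using assms by (auto simp: bij_betw_def)
  have "?f ` std_pairs r = {(i, j). i \<le> j \<and> j < CARD('n)}" (is "_ = ?R")
  proof
    show "?f ` std_pairs r \<subseteq> ?R" using im by (auto simp: std_pairs_def)
    show "?R \<subseteq> ?f ` std_pairs r"
    proof
      fix t assume "t \<in> ?R"
      then obtain i j where t: "t = (i, j)" "i \<le> j" "j < CARD('n)" by auto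
      then have "i \<in> range r" "j \<in> range r" using im by auto
      then obtain i' j' where "i = r i'" "j = r j'" by blast
      then show "t \<in> ?f ` std_pairs r" using t by (auto simp: std_pairs_def image_iff)
    qed
  qed
  moreover have "card (?f ` std_pairs r) = card (std_pairs r)"
    using inj by (intro card_image) (auto simp: inj_on_def)
  ultimately show ?thesis using card_std_pairs_nat[of "CARD('n)"] by simp
qed

text \<open>The vectors \<open>hom_coord a x\<close> for \<open>x\<close> in \<open>V\<close> fill
  an open piece of the affine hyperplane \<open>Y\<^sub>a = 1\<close>. Vanishing spreads along lines
  to the whole hyperplane, by homogeneity to \<open>Y\<^sub>a \<noteq> 0\<close>, and by the
  parallelogram identity to \<open>Y\<^sub>a = 0\<close>.\<close>

lemma quadratic_form_zero_on_affine_open: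
  fixes B :: "real^'n::finite \<Rightarrow> real^'n \<Rightarrow> real" and V :: "(real^'n) set"
  assumes V: "open V" "V \<noteq> {}" and B: "bilinear B"
    and zero: "\<And>x. x \<in> V \<Longrightarrow> B (\<chi> i. hom_coord a x i) (\<chi> i. hom_coord a x i) = 0"
  shows "B Y Y = 0"
proof -
  note ba = bilinear_ladd[OF B] bilinear_radd[OF B] bilinear_lmul[OF B] bilinear_rmul[OF B]
    bilinear_lsub[OF B] bilinear_rsub[OF B]
  obtain x0 where x0: "x0 \<in> V" using V by blast
  define Y0 where "Y0 = (\<chi> i. hom_coord a x0 i)"
  have one: "B Y Y = 0" if "Y $ a = 1" for Y
  proof -
    define W where "W = Y - Y0"
    obtain e where e: "e > 0" "ball x0 e \<subseteq> V" using V x0 openE by blast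
    define N where "N = norm W + 1"
    define t where "t = e / (2 * N)"
    have n1: "N > 0" using norm_ge_zero[of W] unfolding N_def by linarith
    have t: "t > 0" using e n1 by (simp add: t_def)
    have tW: "t * norm W < e"
    proof -
      have "t * norm W \<le> t * N" using t by (simp add: N_def)
      also have "\<dots> = e / 2" using n1 by (simp add: t_def)
      finally show ?thesis using e by linarith
    qed
    have Q: "B (Y0 + s *\<^sub>R W) (Y0 + s *\<^sub>R W) = 0" if "\<bar>s\<bar> \<le> t" for s
    proof -
      have "\<bar>s\<bar> * norm W \<le> t * norm W" using that by (intro mult_right_mono) auto
      then have "x0 + s *\<^sub>R W \<in> V" using e tW by (auto simp: subset_iff dist_norm)
      \<comment> \<open>Both \<open>Y\<close> and \<open>Y0\<close> have \<open>a\<close>-component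
        1, so \<open>W\<close> has \<open>a\<close>-component 0 and moving \<open>x0\<close> along
        \<open>W\<close> moves its homogeneous vector along \<open>W\<close> as well.\<close>
      moreover have "(\<chi> i. hom_coord a (x0 + s *\<^sub>R W) i) = Y0 + s *\<^sub>R W"
        using \<open>Y $ a = 1\<close> by (auto simp: vec_eq_iff hom_coord_def Y0_def W_def)
      ultimately show ?thesis using zero by metis
    qed
    have q: "B Y0 Y0 + s * (B Y0 W + B W Y0) + s * s * B W W = 0" if "\<bar>s\<bar> \<le> t" for s
      using Q[OF that] by (simp add: ba algebra_simps)
    \<comment> \<open>The values at 0, \<open>t\<close> and \<open>- t\<close> determine all
      coefficients of a polynomial of degree 2 in \<open>s\<close>.\<close>
    have "B Y0 Y0 = 0" using q[of 0] t by simp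
    moreover have "t * (B Y0 W + B W Y0) = 0" "t * t * B W W = 0"
      using q[of t] q[of "-t"] q[of 0] t by (simp_all add: algebra_simps)
    ultimately have "B (Y0 + W) (Y0 + W) = 0" using t by (simp add: ba)
    then show ?thesis by (simp add: W_def)
  qed
  have nz: "B Y Y = 0" if "Y $ a \<noteq> 0" for Y
    using one[of "(1 / Y $ a) *\<^sub>R Y"] that by (simp add: ba)
  show ?thesis
  proof (cases "Y $ a = 0")
    case True
    let ?e = "axis a 1 :: real^'n"
    have "B (Y + ?e) (Y + ?e) = 0" "B (Y - ?e) (Y - ?e) = 0" "B ?e ?e = 0"
      using True by (auto intro!: nz)
    then show ?thesis by (simp add: ba)
  qed (rule nz)
qed

definition pluecker :: "'n::finite \<Rightarrow> 'n \<Rightarrow> real^'n \<Rightarrow> real^'n \<Rightarrow> real"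
  where "pluecker i j Y p = Y $ i * p $ j - Y $ j * p $ i"

lemma pluecker_add_left: "pluecker i j (Y + Z) p = pluecker i j Y p + pluecker i j Z p"
  and pluecker_add_right: "pluecker i j Y (p + q) = pluecker i j Y p + pluecker i j Y q"
  by (simp_all add: pluecker_def algebra_simps)

text \<open>The monomial \<open>Y\<^sub>i Y\<^sub>k p\<^sub>j p\<^sub>l\<close> leads in the product for \<open>(i, j, k, l)\<close>: all others have a larger sum of
  ranks of \<open>Y\<close>-indices. So the coefficient of the leading monomial of a term with least such sum
  involves only that term; it is extracted by polarization.\<close>

lemma pluecker_products_independent:
  fixes r :: "'n::finite \<Rightarrow> nat"
  assumes r: "inj r"
    and zero: "\<And>Y p. (\<Sum>(i, j, k, l)\<in>std_quads r. d (i, j, k, l) * (pluecker i j Y p * pluecker k l Y p)) = 0"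
  shows "\<forall>t\<in>std_quads r. d t = 0"
proof (rule ccontr)
  let ?I = "std_quads r"
  define m where "m = (\<lambda>(i, j :: 'n, k, l :: 'n). r i + r k)"
  assume "\<not> ?thesis"
  then have "\<exists>t. t \<in> ?I \<and> d t \<noteq> 0" by blast
  then obtain t0 where t0: "t0 \<in> ?I" "d t0 \<noteq> 0" and min: "\<And>t. t \<in> ?I \<Longrightarrow> d t \<noteq> 0 \<Longrightarrow> m t0 \<le> m t"
    using ex_has_least_nat[of "\<lambda>t. t \<in> ?I \<and> d t \<noteq> 0" _ m] by blast
  obtain \<alpha> \<beta> \<gamma> \<delta> where t0_eq: "t0 = (\<alpha>, \<beta>, \<gamma>, \<delta>)" by (cases t0)
  have o0: "r \<alpha> < r \<beta>" "r \<gamma> < r \<delta>" "r \<alpha> \<le> r \<gamma>" "r \<beta> \<le> r \<delta>"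
    using t0 t0_eq by (auto simp: std_quads_def)
  define e where "e t Y p = (case t of (i, j, k, l) \<Rightarrow> d (i, j, k, l) * (pluecker i j Y p * pluecker k l Y p))" for t Y p
  have G: "(\<Sum>t\<in>?I. e t Y p) = 0" for Y p
    using zero[of Y p] unfolding e_def .
  \<comment> \<open>The factor that multiplies \<open>d t\<close> when the identity is polarized in
    \<open>Y\<close> between the axes \<alpha>, \<gamma> and in \<open>p\<close> between the axes
    \<beta>, \<delta>.\<close>
  define c where "c = (\<lambda>(i, j, k, l). pluecker i j (axis \<alpha> 1) (axis \<beta> 1) * pluecker k l (axis \<gamma> 1) (axis \<delta> 1)
    + pluecker i j (axis \<alpha> 1) (axis \<delta> 1) * pluecker k l (axis \<gamma> 1) (axis \<beta> 1)
    + pluecker i j (axis \<gamma> 1) (axis \<beta> 1) * pluecker k l (axis \<alpha> 1) (axis \<delta> 1)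
    + pluecker i j (axis \<gamma> 1) (axis \<delta> 1) * pluecker k l (axis \<alpha> 1) (axis \<beta> 1))"
  let ?Y = "axis \<alpha> 1 :: real^'n" and ?Z = "axis \<gamma> 1 :: real^'n"
    and ?p = "axis \<beta> 1 :: real^'n" and ?q = "axis \<delta> 1 :: real^'n"
  have "d t * c t = e t (?Y + ?Z) (?p + ?q) - e t (?Y + ?Z) ?p - e t (?Y + ?Z) ?q
      - e t ?Y (?p + ?q) + e t ?Y ?p + e t ?Y ?q - e t ?Z (?p + ?q) + e t ?Z ?p + e t ?Z ?q" for t
  proof -
    obtain i j k l where t: "t = (i, j, k, l)" by (cases t)
    have "D * (a1 * b4 + a2 * b3 + a3 * b2 + a4 * b1) =
      D * ((a1 + a3 + (a2 + a4)) * (b1 + b3 + (b2 + b4))) - D * ((a1 + a3) * (b1 + b3)) - D * ((a2 + a4) * (b2 + b4))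
      - D * ((a1 + a2) * (b1 + b2)) + D * (a1 * b1) + D * (a2 * b2)
      - D * ((a3 + a4) * (b3 + b4)) + D * (a3 * b3) + D * (a4 * b4)"
      for D a1 a2 a3 a4 b1 b2 b3 b4 :: real
      by (simp add: algebra_simps)
    from this[of "d (i, j, k, l)" "pluecker i j ?Y ?p" "pluecker k l ?Z ?q" "pluecker i j ?Y ?q" "pluecker k l ?Z ?p"
        "pluecker i j ?Z ?p" "pluecker k l ?Y ?q" "pluecker i j ?Z ?q" "pluecker k l ?Y ?p"]
    show ?thesis unfolding t e_def c_def prod.case pluecker_add_left pluecker_add_right .
  qed
  then have sum0: "(\<Sum>t\<in>?I. d t * c t) = 0"
    by (simp only: sum_subtractf sum.distrib G)
  have pluecker_axis: "pluecker i j (axis \<mu> 1) (axis \<nu> 1) =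
      (if r i = r \<mu> \<and> r j = r \<nu> then 1 else 0) - (if r j = r \<mu> \<and> r i = r \<nu> then 1 else 0)"
    for i j \<mu> \<nu>
    by (cases "i = \<mu>"; cases "j = \<nu>"; cases "j = \<mu>"; cases "i = \<nu>") (simp_all add: pluecker_def axis_def inj_eq[OF r])
  have off: "d t * c t = 0" if "t \<in> ?I" "t \<noteq> t0" for t
  proof (rule ccontr)
    assume nz: "d t * c t \<noteq> 0"
    obtain i j k l where t: "t = (i, j, k, l)" by (cases t)
    have o: "r i < r j" "r k < r l" "r i \<le> r k" "r j \<le> r l" using that t by (auto simp: std_quads_def)
    have m: "r \<alpha> + r \<gamma> \<le> r i + r k" using min[OF that(1)] nz t t0_eq by (simp add: m_def)
    have ne: "\<not> (r i = r \<alpha> \<and> r j = r \<beta> \<and> r k = r \<gamma> \<and> r l = r \<delta>)"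
      using that(2) t t0_eq by (auto simp: inj_eq[OF r])
    \<comment> \<open>A nonzero product matches each of the pairs \<open>{i, j}\<close> and
      \<open>{k, l}\<close> with one \<open>Y\<close>-axis and one \<open>p\<close>-axis. As
      \<open>i\<close> and \<open>k\<close> have the lower ranks in their pairs,
      \<open>r i + r k\<close> is at most \<open>r \<alpha> + r \<gamma>\<close>. Minimality forces
      equality, so \<open>i\<close> and \<open>k\<close> are the \<open>Y\<close>-axes, and the
      order conditions leave only \<open>t0\<close>.\<close>
    have "pluecker i j ?Y ?p * pluecker k l ?Z ?q = 0" "pluecker i j ?Y ?q * pluecker k l ?Z ?p = 0"
      "pluecker i j ?Z ?p * pluecker k l ?Y ?q = 0" "pluecker i j ?Z ?q * pluecker k l ?Y ?p = 0"
      unfolding pluecker_axis using o o0 m ne by auto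
    then have "c t = 0" by (simp only: c_def t prod.case)
    then show False using nz by simp
  qed
  \<comment> \<open>The last three products repeat the leading one when \<alpha> equals \<gamma> or
    \<beta> equals \<delta>; hence only positivity of \<open>c t0\<close> is claimed, not a
    value.\<close>
  have "pluecker \<alpha> \<beta> ?Y ?p * pluecker \<gamma> \<delta> ?Z ?q = 1" "pluecker \<alpha> \<beta> ?Y ?q * pluecker \<gamma> \<delta> ?Z ?p \<ge> 0"
      "pluecker \<alpha> \<beta> ?Z ?p * pluecker \<gamma> \<delta> ?Y ?q \<ge> 0" "pluecker \<alpha> \<beta> ?Z ?q * pluecker \<gamma> \<delta> ?Y ?p \<ge> 0"
    unfolding pluecker_axis using o0 by auto
  then have "c t0 > 0" by (simp add: c_def t0_eq)
  moreover have "(\<Sum>t\<in>?I - {t0}. d t * c t) = 0"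
    by (intro sum.neutral ballI off) auto
  then have "(\<Sum>t\<in>?I. d t * c t) = d t0 * c t0"
    using sum.remove[OF finite t0(1), of "\<lambda>t. d t * c t"] by simp
  ultimately show False using sum0 t0 by simp
qed

section \<open>A basis of the integrals\<close>

definition basis_fun :: "'n::finite \<Rightarrow> (real^'n) set \<Rightarrow> ('n \<times> 'n) + ('n \<times> 'n \<times> 'n \<times> 'n)
    \<Rightarrow> (real^'n) \<times> (real^'n) \<Rightarrow> real"
  where "basis_fun a V s = (case s of
      Inl (i, j) \<Rightarrow> extend_zero V (stackel_integral a i j)
    | Inr (i, j, k, l) \<Rightarrow> extend_zero V (killing_product a i j k l))"

lemma killing_field_eq_pluecker: "killing_field a i j (x, p) = pluecker i j (\<chi> i. hom_coord a x i) (\<chi> i. mom_coord a p i)"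
  by (simp add: killing_field_def pluecker_def)

lemma pluecker_scaleR_left: "pluecker i j (c *\<^sub>R Y) p = c * pluecker i j Y p"
  by (simp add: pluecker_def algebra_simps)

text \<open>At the momentum \<open>axis a 1\<close> all products of Killing fields vanish and the
  integrals of the other family reduce to \<open>Y\<^sub>i Y\<^sub>j / x\<^sub>a\<close>, so their
  coefficients can be removed on their own. What is left is a relation between products of minors,
  to be extended from \<open>Y\<^sub>a = 1\<close>, \<open>q\<^sub>a = 0\<close> to arbitrary pairs
  of vectors.\<close>

lemma basis_fun_coeffs_zero:
  fixes r :: "'n::finite \<Rightarrow> nat" and V :: "(real^'n) set"
  assumes r: "inj r" and V: "open V" "V \<noteq> {}" "V \<subseteq> {x. 0 < x $ a}"
    and zero: "\<And>z. (\<Sum>s\<in>std_pairs r <+> std_quads r. c s * basis_fun a V s z) = 0"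
  shows "\<forall>s\<in>std_pairs r <+> std_quads r. c s = 0"
proof -
  let ?Y = "\<lambda>x. (\<chi> i. hom_coord a x i)"
  have sum0: "(\<Sum>(i, j)\<in>std_pairs r. c (Inl (i, j)) * stackel_integral a i j (x, p)) +
      (\<Sum>(i, j, k, l)\<in>std_quads r. c (Inr (i, j, k, l)) * killing_product a i j k l (x, p)) = 0"
    if "x \<in> V" for x p
    using zero[of "(x, p)"] that
    by (simp add: sum.Plus basis_fun_def extend_zero_def split_beta case_prod_unfold)
  have pairs: "c (Inl (i, j)) = 0" if ij: "(i, j) \<in> std_pairs r" for i j
  proof -
    let ?B = "\<lambda>Y Z :: real^'n. \<Sum>(i, j)\<in>std_pairs r. c (Inl (i, j)) * (Y $ i * Z $ j)"
    have B: "bilinear ?B"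
      by (auto simp: bilinear_def linear_iff split_beta algebra_simps sum.distrib sum_distrib_left)
    have "?B (?Y x) (?Y x) = 0" if "x \<in> V" for x
    proof -
      have xa: "x $ a > 0" using V that by auto
      have "stackel_integral a i j (x, axis a 1) = (?Y x $ i * ?Y x $ j) / x $ a" for i j
        by (simp add: stackel_integral_def energy_def mom_coord_def axis_def inner_axis_axis[unfolded axis_def])
      moreover have "killing_product a i j k l (x, axis a 1) = 0" for i j k l
        by (simp add: killing_product_def killing_field_def mom_coord_def axis_def)
      ultimately have "(\<Sum>(i, j)\<in>std_pairs r. c (Inl (i, j)) * (?Y x $ i * ?Y x $ j)) / x $ a = 0"
        using sum0[OF that, of "axis a 1"] by (simp add: sum_divide_distrib split_beta)
      then show ?thesis using xa by simp
    qed
    then have B0: "?B Y Y = 0" for Y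
      using quadratic_form_zero_on_affine_open[OF V(1,2) B] by blast
    have "B (y + z) (y + z) - B y y - B z z = B y z + B z y" if "bilinear B"
      for B :: "real^'n \<Rightarrow> real^'n \<Rightarrow> real" and y z
      by (simp add: bilinear_ladd[OF that] bilinear_radd[OF that])
    from this[OF B, of "axis i 1" "axis j 1"]
    have sym: "?B (axis i 1) (axis j 1) + ?B (axis j 1) (axis i 1) = 0" unfolding B0 by simp
    have val: "?B (axis i 1) (axis j 1) = (if (i, j) \<in> std_pairs r then c (Inl (i, j)) else 0)" for i j
    proof -
      have "?B (axis i 1) (axis j 1) = (\<Sum>t\<in>std_pairs r. if t = (i, j) then c (Inl t) else 0)"
        by (intro sum.cong refl) (auto simp: axis_def split: if_splits)
      then show ?thesis by simp
    qed
    show ?thesis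
    proof (cases "i = j")
      case True then show ?thesis using sym ij by (simp add: val)
    next
      case False
      then have "(j, i) \<notin> std_pairs r" using ij r by (auto simp: std_pairs_def dest: inj_onD)
      then show ?thesis using sym ij by (simp add: val)
    qed
  qed
  have quads: "\<forall>t\<in>std_quads r. c (Inr t) = 0"
  proof (rule pluecker_products_independent[OF r])
    let ?G = "\<lambda>Y p. \<Sum>(i, j, k, l)\<in>std_quads r. c (Inr (i, j, k, l)) * (pluecker i j Y p * pluecker k l Y p)"
    fix Y p :: "real^'n"
    let ?B = "\<lambda>Y Z. \<Sum>(i, j, k, l)\<in>std_quads r. c (Inr (i, j, k, l)) * (pluecker i j Y p * pluecker k l Z p)"
    have B: "bilinear ?B"
      by (auto simp: bilinear_def linear_iff split_beta algebra_simps sum.distrib sum_distrib_left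
          pluecker_add_left pluecker_scaleR_left)
    have "?B (?Y x) (?Y x) = 0" if x: "x \<in> V" for x
    proof -
      \<comment> \<open>Subtracting a multiple of \<open>Y\<close> from \<open>p\<close> changes no
        minor; since \<open>Y\<^sub>a = 1\<close>, this multiple produces a momentum with
        \<open>q\<^sub>a = 0\<close>, where minors are Killing fields.\<close>
      define q where "q = p - p $ a *\<^sub>R ?Y x"
      have "q $ a = 0" by (simp add: q_def hom_coord_def)
      then have q: "(\<chi> i. mom_coord a q i) = q" by (auto simp: vec_eq_iff mom_coord_def)
      have "pluecker i j (?Y x) p = pluecker i j (?Y x) q" for i j
        by (simp add: pluecker_def q_def algebra_simps)
      then have "?B (?Y x) (?Y x) = (\<Sum>(i, j, k, l)\<in>std_quads r. c (Inr (i, j, k, l)) * killing_product a i j k l (x, q))"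
        by (simp add: killing_product_def killing_field_eq_pluecker q)
      moreover have "(\<Sum>(i, j)\<in>std_pairs r. c (Inl (i, j)) * stackel_integral a i j (x, q)) = 0"
        by (intro sum.neutral) (auto simp: pairs)
      ultimately show ?thesis using sum0[OF x, of q] by simp
    qed
    then show "?G Y p = 0"
      using quadratic_form_zero_on_affine_open[OF V(1,2) B] by blast
  qed
  show ?thesis using pairs quads by auto
qed

text \<open>Straightening. Antisymmetry and commutativity order the indices inside and between the
  columns; the only remaining violation, in the second row, is removed by a single use of the
  three-term Pluecker relation.\<close>

lemma killing_product_in_span:
  fixes r :: "'n::finite \<Rightarrow> nat"
  assumes r: "inj r"
  shows "extend_zero V (killing_product a i j k l) \<in> fun_space.span (basis_fun a V ` (std_pairs r <+> std_quads r))"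
    (is "?K i j k l \<in> ?S")
proof -
  have anti: "?K i j k l = fun_scale (-1) (?K j i k l)" for i j k l
    by (auto simp: fun_eq_iff fun_scale_def extend_zero_def killing_product_def killing_field_def algebra_simps)
  have comm: "?K i j k l = ?K k l i j" for i j k l
    by (auto simp: fun_eq_iff extend_zero_def killing_product_def)
  have pluecker: "?K i j k l = fun_scale (-1) (?K i k l j) + ?K i l k j" for i j k l
    by (auto simp: fun_eq_iff fun_scale_def extend_zero_def killing_product_def killing_field_def algebra_simps)
  have flip: "?K i j k l \<in> ?S" if "?K j i k l \<in> ?S" for i j k l
    using fun_space.span_scale[OF that] by (subst anti)
  have zero: "?K i i k l \<in> ?S" for i k l
  proof -
    have "?K i i k l = 0" by (auto simp: fun_eq_iff extend_zero_def killing_product_def killing_field_def)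
    then show ?thesis using fun_space.span_zero by metis
  qed
  have base: "?K i j k l \<in> ?S" if "(i, j, k, l) \<in> std_quads r" for i j k l
  proof -
    have "basis_fun a V (Inr (i, j, k, l)) \<in> ?S" using that by (intro fun_space.span_base imageI) auto
    then show ?thesis by (simp add: basis_fun_def)
  qed
  have std: "?K i j k l \<in> ?S" if o: "r i < r j" "r k < r l" "r i \<le> r k" for i j k l
  proof (cases "r j \<le> r l")
    case True then show ?thesis using o by (intro base) (auto simp: std_quads_def)
  next
    case False
    \<comment> \<open>Both terms of the relation are standard already, except that the first one
      vanishes when \<open>i = k\<close>.\<close>
    have "r i < r k \<or> i = k" using o(3) by (auto simp: le_less inj_eq[OF r])
    then have "(i, k, l, j) \<in> std_quads r \<or> i = k" "(i, l, k, j) \<in> std_quads r"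
      using o False by (auto simp: std_quads_def)
    then have "?K i k l j \<in> ?S" "?K i l k j \<in> ?S" using base zero by auto
    then have "fun_scale (-1) (?K i k l j) + ?K i l k j \<in> ?S"
      by (intro fun_space.span_add fun_space.span_scale)
    then show ?thesis by (simp only: pluecker[symmetric])
  qed
  have half: "?K i j k l \<in> ?S" if "r i < r j" "r k < r l" for i j k l
    using std[OF that] std[OF that(2,1)] comm[of i j k l] by (cases "r i \<le> r k") auto
  have left: "?K i j k l \<in> ?S" if "r k < r l" for i j k l
  proof (cases "r i" "r j" rule: linorder_cases)
    case less then show ?thesis using half that by blast
  next
    case equal then show ?thesis using zero injD[OF r equal] by simp
  next
    case greater then show ?thesis using half[OF greater that] flip by blast
  qed
  show ?thesis
  proof (cases "r k" "r l" rule: linorder_cases)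
    case less then show ?thesis using left by blast
  next
    case equal then show ?thesis using zero[of k i j] comm[of i j k l] injD[OF r equal] by simp
  next
    case greater
    then have "?K l k i j \<in> ?S" using left comm by metis
    then show ?thesis using flip comm by metis
  qed
qed

lemma stackel_integral_in_span:
  fixes r :: "'n::finite \<Rightarrow> nat"
  shows "extend_zero V (stackel_integral a i j) \<in> fun_space.span (basis_fun a V ` (std_pairs r <+> std_quads r))"
    (is "?K i j \<in> ?S")
proof -
  have comm: "?K i j = ?K j i" for i j by (auto simp: fun_eq_iff extend_zero_def stackel_integral_def algebra_simps)
  have base: "?K i j \<in> ?S" if "(i, j) \<in> std_pairs r" for i j
  proof -
    have "basis_fun a V (Inl (i, j)) \<in> ?S" using that by (intro fun_space.span_base imageI) auto
    then show ?thesis by (simp add: basis_fun_def)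
  qed
  show ?thesis using base[of i j] base[of j i] comm[of i j] by (cases "r i \<le> r j") (auto simp: std_pairs_def)
qed

section \<open>Consequences of the Killing equation\<close>

abbreviation pd :: "'n::finite \<Rightarrow> (real^'n \<Rightarrow> real) \<Rightarrow> real^'n \<Rightarrow> real"
  where "pd i \<equiv> dir_deriv (axis i 1)"

lemma smooth_on_nth: "smooth_on S (\<lambda>x::real^'n::finite. x $ i)"
  by (intro smooth_on_bounded_linear bounded_linear_vec_nth)

lemma pd_nth: "pd i (\<lambda>x::real^'n::finite. x $ a) x = (if i = a then 1 else 0)"
  by (subst dir_deriv_bounded_linear) (auto simp: bounded_linear_vec_nth axis_def)

lemma dir_deriv_sum:
  assumes "open S" "\<And>i. i \<in> I \<Longrightarrow> smooth_on S (f i)" "x \<in> S"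
  shows "dir_deriv v (\<lambda>x. \<Sum>i\<in>I. f i x) x = (\<Sum>i\<in>I. dir_deriv v (f i) x)"
  using assms(2)
proof (induction I rule: infinite_finite_induct)
  case (insert i I)
  then have "smooth_on S (\<lambda>x. \<Sum>i\<in>I. f i x)" by (intro smooth_on_sum assms(1)) auto
  then show ?case using insert by (simp add: dir_deriv_add[OF _ _ assms(3)])
qed (simp_all add: dir_deriv_const)

lemma dir_deriv_eq_sum_pd:
  fixes f :: "real^'n::finite \<Rightarrow> real"
  assumes "smooth_on S f" "x \<in> S"
  shows "dir_deriv v f x = (\<Sum>i\<in>UNIV. v $ i * pd i f x)"
proof -
  have l: "linear (\<lambda>v. dir_deriv v f x)"
    using has_derivative_linear[OF has_derivative_dir_deriv[OF assms]] .
  have "dir_deriv v f x = dir_deriv (\<Sum>i\<in>UNIV. v $ i *\<^sub>R axis i 1) f x"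
    using basis_expansion[of v] by (simp add: scalar_mult_eq_scaleR)
  then show ?thesis by (simp add: linear_sum[OF l] linear_cmul[OF l])
qed

text \<open>The place where connectedness of the domain enters: it is what makes an integral
  globally a polynomial expression with one set of coefficients.\<close>

lemma pd_zero_imp_constant:
  fixes f :: "real^'n::finite \<Rightarrow> real"
  assumes V: "open V" "connected V" and S: "smooth_on V f"
    and zero: "\<And>i x. x \<in> V \<Longrightarrow> pd i f x = 0"
  shows "\<exists>c. \<forall>x\<in>V. f x = c"
proof -
  have D: "(f has_derivative (\<lambda>v. 0)) (at x)" if "x \<in> V" for x
  proof -
    have "dir_deriv v f x = 0" for v by (subst dir_deriv_eq_sum_pd[OF S that]) (simp add: zero[OF that])
    then show ?thesis using has_derivative_dir_deriv[OF S that] by simp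
  qed
  then have "f constant_on V"
    by (intro has_derivative_zero_connected_constant_on[of V "{}"] V smooth_on_imp_continuous_on[OF S])
      (auto intro: has_derivative_at_withinI)
  then show ?thesis by (auto simp: constant_on_def)
qed

lemma dir_deriv_commute3:
  assumes V: "open V" and S: "smooth_on V f" and x: "x \<in> V"
  shows "dir_deriv u (dir_deriv v (dir_deriv w f)) x = dir_deriv v (dir_deriv w (dir_deriv u f)) x"
proof -
  have "dir_deriv u (dir_deriv v (dir_deriv w f)) x = dir_deriv v (dir_deriv u (dir_deriv w f)) x"
    by (intro dir_deriv_commute[OF V _ x] smooth_on_dir_deriv S)
  also have "\<dots> = dir_deriv v (dir_deriv w (dir_deriv u f)) x"
    by (intro dir_deriv_cong[OF V x] dir_deriv_commute[OF V S])
  finally show ?thesis .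
qed

text \<open>A cubic form determines only the symmetrization of its coefficients. The symmetrization
  is recovered by inclusion and exclusion over sums of three basis vectors, which may
  coincide.\<close>

lemma cubic_form_zero:
  fixes T :: "'n::finite \<Rightarrow> 'n \<Rightarrow> 'n \<Rightarrow> real"
  assumes zero: "\<And>p :: real^'n. (\<Sum>i\<in>UNIV. \<Sum>k\<in>UNIV. \<Sum>l\<in>UNIV. T i k l * (p $ i * p $ k * p $ l)) = 0"
  shows "T i k l + T i l k + T k i l + T k l i + T l i k + T l k i = 0"
proof -
  define t where "t p q r = (\<Sum>i\<in>UNIV. \<Sum>k\<in>UNIV. \<Sum>l\<in>UNIV. T i k l * (p $ i * q $ k * r $ l))"
    for p q r :: "real^'n"
  have add: "t (p + p') q r = t p q r + t p' q r" "t p (q + q') r = t p q r + t p q' r"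
    "t p q (r + r') = t p q r + t p q r'" for p q r p' q' r'
    by (simp_all add: t_def sum.distrib[symmetric] algebra_simps)
  have t0: "t p p p = 0" for p using zero by (simp add: t_def)
  have ax: "t (axis i 1) (axis k 1) (axis l 1) = T i k l" for i k l
  proof -
    have "T i' k' l' * (axis i 1 $ i' * axis k 1 $ k' * axis l 1 $ l') =
      (if i' = i then if k' = k then if l' = l then T i k l else 0 else 0 else 0)" for i' k' l'
      by (simp add: axis_def)
    moreover have "(\<Sum>l'\<in>UNIV. if i' = i then if k' = k then if l' = l then T i k l else 0 else 0 else 0) =
      (if i' = i then if k' = k then T i k l else 0 else 0)" for i' k'
      by simp
    moreover have "(\<Sum>k'\<in>UNIV. if i' = i then if k' = k then T i k l else 0 else 0) =
      (if i' = i then T i k l else 0)" for i'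
      by simp
    ultimately show ?thesis by (simp add: t_def)
  qed
  let ?p = "axis i 1" and ?q = "axis k 1" and ?r = "axis l 1"
  have "t ?p ?q ?r + t ?p ?r ?q + t ?q ?p ?r + t ?q ?r ?p + t ?r ?p ?q + t ?r ?q ?p =
    t (?p + ?q + ?r) (?p + ?q + ?r) (?p + ?q + ?r) - t (?p + ?q) (?p + ?q) (?p + ?q)
    - t (?q + ?r) (?q + ?r) (?q + ?r) - t (?p + ?r) (?p + ?r) (?p + ?r) + t ?p ?p ?p + t ?q ?q ?q + t ?r ?r ?r"
    unfolding add by linarith
  then show ?thesis unfolding t0 ax by simp
qed

text \<open>For five fixed indices the unknowns are labelled by the pair of final indices and the equations by
  the pair of indices kept in front. The system is the adjacency matrix of the Petersen graph, which
  is invertible (eigenvalues 3, 1, -2).\<close>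

lemma symmetrized_zero:
  fixes T :: "'i \<Rightarrow> 'i \<Rightarrow> 'i \<Rightarrow> 'i \<Rightarrow> 'i \<Rightarrow> real"
  assumes s1: "\<And>a b c k l. T a b c k l = T b a c k l" and s2: "\<And>a b c k l. T a b c k l = T a c b k l"
    and s3: "\<And>a b c k l. T a b c k l = T a b c l k"
    and cyc: "\<And>a b i k l. T a b i k l + T a b k l i + T a b l i k = 0"
  shows "T a b c k l = 0"
proof -
  \<comment> \<open>The thirty terms of the ten equations below are rewritten in ten
    representatives, one for each choice of the final two indices.\<close>
  have "T a b k l c = T a b k c l" "T a c b k l = T a b c k l" "T a c k l b = T a c k b l" "T a k b c l = T a b k c l" "T a k c l b = T a c k b l" "T a l b c k = T a b l c k" "T a l c k b = T a c l b k" "T a l k b c = T a k l b c" "T b c a k l = T a b c k l" "T b c k l a = T b c k a l" "T b k a c l = T a b k c l" "T b k c l a = T b c k a l" "T b l a c k = T a b l c k" "T b l c k a = T b c l a k" "T b l k a c = T b k l a c" "T c k a b l = T a c k b l" "T c k b l a = T b c k a l" "T c l a b k = T a c l b k" "T c l b k a = T b c l a k" "T c l k a b = T c k l a b" "T k l a b c = T a k l b c" "T k l b c a = T b k l a c" "T k l c a b = T c k l a b"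
    by (metis s1 s2 s3)+
  then show ?thesis
    using cyc[of a b c k l] cyc[of a c b k l] cyc[of a k b c l] cyc[of a l b c k] cyc[of b c a k l] cyc[of b k a c l] cyc[of b l a c k] cyc[of c k a b l] cyc[of c l a b k] cyc[of k l a b c]
    by linarith
qed

text \<open>Integration from the top: second derivatives are constant, and subtracting their
  contribution leaves something with zero gradient, twice. The derivatives are part of the
  conclusion because later arguments compare coefficients through them at one point.\<close>

lemma quadratic_polynomial:
  fixes f :: "real^'n::finite \<Rightarrow> real"
  assumes V: "open V" "connected V" "V \<noteq> {}" and S: "smooth_on V f"
    and third: "\<And>i j k x. x \<in> V \<Longrightarrow> pd i (pd j (pd k f)) x = 0"
  shows "\<exists>c0 c1 c2. (\<forall>i j. \<forall>x\<in>V. pd i (pd j f) x = 2 * c2 i j) \<and>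
    (\<forall>i. \<forall>x\<in>V. pd i f x = c1 i + 2 * (\<Sum>j\<in>UNIV. c2 i j * x $ j)) \<and>
    (\<forall>x\<in>V. f x = c0 + (\<Sum>i\<in>UNIV. c1 i * x $ i) + (\<Sum>i\<in>UNIV. \<Sum>j\<in>UNIV. c2 i j * (x $ i * x $ j)))"
proof -
  have "\<exists>c. \<forall>x\<in>V. pd i (pd j f) x = c" for i j
    using third by (intro pd_zero_imp_constant V smooth_on_dir_deriv S) auto
  then obtain c where c: "\<And>i j x. x \<in> V \<Longrightarrow> pd i (pd j f) x = c i j" by metis
  define c2 where "c2 i j = c i j / 2" for i j
  have c2: "pd i (pd j f) x = 2 * c2 i j" if "x \<in> V" for i j x using c[OF that] by (simp add: c2_def)
  obtain x0 where x0: "x0 \<in> V" using V by blast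
  have sym: "c2 i j = c2 j i" for i j
    using dir_deriv_commute[OF V(1) S x0, of "axis i 1" "axis j 1"] c[OF x0] by (simp add: c2_def)
  note sm = smooth_on_add smooth_on_minus smooth_on_mult smooth_on_const smooth_on_sum smooth_on_nth
    smooth_on_dir_deriv S V(1)
  have "\<exists>c. \<forall>x\<in>V. pd i f x - 2 * (\<Sum>j\<in>UNIV. c2 i j * x $ j) = c" for i
  proof (rule pd_zero_imp_constant[OF V(1,2)])
    show "smooth_on V (\<lambda>x. pd i f x - 2 * (\<Sum>j\<in>UNIV. c2 i j * x $ j))"
      by (intro sm)
    fix k x assume x: "x \<in> V"
    show "pd k (\<lambda>x. pd i f x - 2 * (\<Sum>j\<in>UNIV. c2 i j * x $ j)) x = 0"
      by (simp add: dir_deriv_minus[OF _ _ x] dir_deriv_cmult[OF _ x] dir_deriv_sum[OF V(1) _ x] sm pd_nth c2[OF x]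
          if_distrib sym[of i k] cong: if_cong)
  qed
  then obtain c1 where c1: "\<And>i x. x \<in> V \<Longrightarrow> pd i f x - 2 * (\<Sum>j\<in>UNIV. c2 i j * x $ j) = c1 i" by metis
  have "\<exists>c. \<forall>x\<in>V. f x - (\<Sum>i\<in>UNIV. c1 i * x $ i) - (\<Sum>i\<in>UNIV. \<Sum>j\<in>UNIV. c2 i j * (x $ i * x $ j)) = c"
  proof (rule pd_zero_imp_constant[OF V(1,2)])
    show "smooth_on V (\<lambda>x. f x - (\<Sum>i\<in>UNIV. c1 i * x $ i) - (\<Sum>i\<in>UNIV. \<Sum>j\<in>UNIV. c2 i j * (x $ i * x $ j)))"
      by (intro sm)
    fix k x assume x: "x \<in> V"
    have l: "pd k (\<lambda>x. \<Sum>i\<in>UNIV. c1 i * x $ i) x = c1 k"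
      by (simp add: dir_deriv_cmult[OF _ x] dir_deriv_sum[OF V(1) _ x] sm pd_nth if_distrib cong: if_cong)
    have "pd k (\<lambda>x. \<Sum>i\<in>UNIV. \<Sum>j\<in>UNIV. c2 i j * (x $ i * x $ j)) x =
        (\<Sum>i\<in>UNIV. \<Sum>j\<in>UNIV. (if k = j then c2 i j * x $ i else 0) + (if k = i then c2 i j * x $ j else 0))"
      by (simp add: dir_deriv_sum[OF V(1) _ x] dir_deriv_cmult[OF _ x] dir_deriv_mult[OF _ _ x] sm pd_nth)
        (intro sum.cong refl, auto simp: algebra_simps)
    also have "\<dots> = (\<Sum>i\<in>UNIV. c2 i k * x $ i) + (\<Sum>j\<in>UNIV. c2 k j * x $ j)"
    proof -
      have "(\<Sum>i\<in>UNIV. \<Sum>j\<in>UNIV. if k = i then c2 i j * x $ j else 0) = (\<Sum>j\<in>UNIV. c2 k j * x $ j)"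
        by (subst sum.swap) simp
      then show ?thesis by (simp add: sum.distrib)
    qed
    also have "\<dots> = 2 * (\<Sum>j\<in>UNIV. c2 k j * x $ j)" by (simp add: sym[of _ k])
    finally have q: "pd k (\<lambda>x. \<Sum>i\<in>UNIV. \<Sum>j\<in>UNIV. c2 i j * (x $ i * x $ j)) x =
        2 * (\<Sum>j\<in>UNIV. c2 k j * x $ j)" .
    show "pd k (\<lambda>x. f x - (\<Sum>i\<in>UNIV. c1 i * x $ i) - (\<Sum>i\<in>UNIV. \<Sum>j\<in>UNIV. c2 i j * (x $ i * x $ j))) x = 0"
      using c1[OF x, of k] by (simp add: dir_deriv_minus[OF _ _ x] sm l q)
  qed
  then obtain c0 where "\<forall>x\<in>V. f x - (\<Sum>i\<in>UNIV. c1 i * x $ i) - (\<Sum>i\<in>UNIV. \<Sum>j\<in>UNIV. c2 i j * (x $ i * x $ j)) = c0"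
    by blast
  then show ?thesis using c2 c1
    by (intro exI[of _ c0] exI[of _ c1] exI[of _ c2]) (auto simp: algebra_simps)
qed

text \<open>Prolongation of the Killing equation: differentiating it twice yields linear relations
  between third derivatives alone, and with the symmetry of partial derivatives these form the
  system of \<open>symmetrized_zero\<close>.\<close>

lemma flat_killing_third_derivatives:
  fixes K :: "'n::finite \<Rightarrow> 'n \<Rightarrow> real^'n \<Rightarrow> real"
  assumes V: "open V" and S: "\<And>k l. smooth_on V (K k l)" and sym: "\<And>k l. K k l = K l k"
    and killing: "\<And>i k l x. x \<in> V \<Longrightarrow> pd i (K k l) x + pd k (K l i) x + pd l (K i k) x = 0"
    and x: "x \<in> V"
  shows "pd a (pd b (pd c (K k l))) x = 0"
proof -
  define T where "T a b c k l = pd a (pd b (pd c (K k l))) x" for a b c k l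
  have "T a b c k l = 0"
  proof (rule symmetrized_zero[of T])
    fix a b c k l i
    show "T a b c k l = T b a c k l" unfolding T_def
      by (intro dir_deriv_commute[OF V _ x] smooth_on_dir_deriv S)
    show "T a b c k l = T a c b k l" unfolding T_def
      by (intro dir_deriv_cong[OF V x] dir_deriv_commute[OF V S])
    show "T a b c k l = T a b c l k" unfolding T_def by (simp add: sym[of k l])
    have 1: "pd b (pd i (K k l)) x + pd b (pd k (K l i)) x + pd b (pd l (K i k)) x = 0" if x: "x \<in> V" for x
    proof -
      have "pd b (\<lambda>x. pd i (K k l) x + pd k (K l i) x + pd l (K i k) x) x = pd b (\<lambda>x. 0) x"
        by (rule dir_deriv_cong[OF V x]) (rule killing)
      then show ?thesis by (simp add: dir_deriv_add[OF _ _ x] smooth_on_add smooth_on_dir_deriv S V dir_deriv_const)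
    qed
    have "pd a (\<lambda>x. pd b (pd i (K k l)) x + pd b (pd k (K l i)) x + pd b (pd l (K i k)) x) x = pd a (\<lambda>x. 0) x"
      by (rule dir_deriv_cong[OF V x]) (rule 1)
    then show "T a b i k l + T a b k l i + T a b l i k = 0"
      unfolding T_def by (simp add: dir_deriv_add[OF _ _ x] smooth_on_add smooth_on_dir_deriv S V dir_deriv_const)
  qed
  then show ?thesis by (simp add: T_def)
qed

text \<open>The defect \<open>b = B + x\<^sub>a \<partial>\<^sub>j A\<close> satisfies \<open>2 x\<^sub>a \<partial>\<^sub>a b = - b\<close>; equality of the mixed derivatives of \<open>C\<close>
  then yields both \<open>4 x\<^sub>a\<^sup>2 \<partial>\<^sub>j\<partial>\<^sub>j b = - 15 b\<close> and \<open>4 x\<^sub>a\<^sup>2 \<partial>\<^sub>j\<partial>\<^sub>j b = 5 b\<close>.\<close>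

lemma planar_system:
  fixes A B C :: "real^'n::finite \<Rightarrow> real"
  assumes V: "open V" "V \<subseteq> {x. 0 < x $ a}" and j: "j \<noteq> a"
    and S: "smooth_on V A" "smooth_on V B" "smooth_on V C"
    and e1: "\<And>x. x \<in> V \<Longrightarrow> x $ a * pd a A x = - A x"
    and e2: "\<And>x. x \<in> V \<Longrightarrow> x $ a * (2 * pd a B x + pd j A x) = - B x"
    and e3: "\<And>x. x \<in> V \<Longrightarrow> x $ a * (pd a C x + 2 * pd j B x) = - A x"
    and e4: "\<And>x. x \<in> V \<Longrightarrow> x $ a * pd j C x = - B x"
    and x: "x \<in> V"
  shows "B x = - x $ a * pd j A x"
proof -
  define b where "b x = B x + x $ a * pd j A x" for x
  have oV: "open V" by fact
  note sm = smooth_on_add smooth_on_minus smooth_on_mult smooth_on_const smooth_on_nth smooth_on_dir_deriv S V(1)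
  have Sb: "smooth_on V b" unfolding b_def[abs_def] by (intro sm)
  have pj: "pd j (\<lambda>x. x $ a) x = 0" "pd a (\<lambda>x. x $ a) x = 1" for x :: "real^'n"
    using j by (auto simp: pd_nth)
  have s1: "x $ a * pd j (pd a A) x = - pd j A x" if x: "x \<in> V" for x
  proof -
    have "pd j (\<lambda>x. x $ a * pd a A x) x = pd j (\<lambda>x. - A x) x" by (rule dir_deriv_cong[OF oV x]) (rule e1)
    then show ?thesis by (simp add: dir_deriv_mult[OF _ _ x] dir_deriv_uminus[OF _ x] sm pj)
  qed
  have bx: "pd a b x = pd a B x" if x: "x \<in> V" for x
  proof -
    have "pd a b x = pd a B x + (x $ a * pd a (pd j A) x + pd j A x)"
      unfolding b_def[abs_def] by (simp add: dir_deriv_add[OF _ _ x] dir_deriv_mult[OF _ _ x] sm pj)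
    then show ?thesis using s1[OF x] dir_deriv_commute[OF oV S(1) x, of "axis a 1" "axis j 1"] by simp
  qed
  have s2: "2 * (x $ a * pd a b x) = - b x" if "x \<in> V" for x
    using e2[OF that] bx[OF that] by (simp add: b_def algebra_simps)
  have s3: "x $ a * (pd j (pd a C) x + 2 * pd j (pd j B) x) = - pd j A x" if x: "x \<in> V" for x
  proof -
    have "pd j (\<lambda>x. x $ a * (pd a C x + 2 * pd j B x)) x = pd j (\<lambda>x. - A x) x" by (rule dir_deriv_cong[OF oV x]) (rule e3)
    then show ?thesis by (simp add: dir_deriv_add[OF _ _ x] dir_deriv_mult[OF _ _ x] dir_deriv_uminus[OF _ x] dir_deriv_const sm pj)
  qed
  have s4: "pd j C x + x $ a * pd j (pd a C) x = - pd a B x" if x: "x \<in> V" for x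
  proof -
    have "pd a (\<lambda>x. x $ a * pd j C x) x = pd a (\<lambda>x. - B x) x" by (rule dir_deriv_cong[OF oV x]) (rule e4)
    then show ?thesis using dir_deriv_commute[OF oV S(3) x, of "axis a 1" "axis j 1"]
      by (simp add: dir_deriv_mult[OF _ _ x] dir_deriv_uminus[OF _ x] sm pj)
  qed
  \<comment> \<open>Elimination of \<open>C\<close>: one mixed derivative of \<open>C\<close> is
    computed from \<open>e3\<close> and from \<open>e4\<close>. The defect \<open>b\<close> measures
    their mismatch.\<close>
  have s6: "4 * (x $ a * x $ a) * pd j (pd j B) x = - 3 * b x" if x: "x \<in> V" for x
  proof -
    have "4 * (X * X) * Bjj = - 3 * b'" if "X * (Cja + 2 * Bjj) = - Aj" "Cj + X * Cja = - Ba" "X * Cj = - B'"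
      "2 * (X * Ba) = - b'" "b' = B' + X * Aj" for X Cja Bjj Aj Cj Ba B' b' :: real
      using that by algebra
    from this[OF s3[OF x] s4[OF x] e4[OF x] s2[OF x, unfolded bx[OF x]]] show ?thesis by (simp add: b_def)
  qed
  have s5: "2 * (x $ a * pd j (pd j (pd a b)) x) = - pd j (pd j b) x" if x: "x \<in> V" for x
  proof -
    have 1: "2 * (x $ a * pd j (pd a b) x) = - pd j b x" if x: "x \<in> V" for x
    proof -
      have "pd j (\<lambda>x. 2 * (x $ a * pd a b x)) x = pd j (\<lambda>x. - b x) x" by (rule dir_deriv_cong[OF oV x]) (rule s2)
      then show ?thesis by (simp add: dir_deriv_mult[OF _ _ x] dir_deriv_uminus[OF _ x] dir_deriv_const sm Sb pj)
    qed
    have "pd j (\<lambda>x. 2 * (x $ a * pd j (pd a b) x)) x = pd j (\<lambda>x. - pd j b x) x" by (rule dir_deriv_cong[OF oV x]) (rule 1)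
    then show ?thesis by (simp add: dir_deriv_mult[OF _ _ x] dir_deriv_uminus[OF _ x] dir_deriv_const sm Sb pj)
  qed
  have Bb: "pd a (pd j (pd j B)) x = pd j (pd j (pd a b)) x" if x: "x \<in> V" for x
  proof -
    have "pd a (pd j (pd j B)) x = pd j (pd j (pd a B)) x" by (rule dir_deriv_commute3[OF oV S(2) x])
    also have "pd j (pd a B) y = pd j (pd a b) y" if "y \<in> V" for y
      by (rule dir_deriv_cong[OF oV that]) (simp add: bx)
    then have "pd j (pd j (pd a B)) x = pd j (pd j (pd a b)) x"
      by (rule dir_deriv_cong[OF oV x])
    finally show ?thesis .
  qed
  have s8: "4 * (x $ a * x $ a) * pd j (pd j b) x = - 15 * b x" if x: "x \<in> V" for x
  proof -
    have "pd a (\<lambda>x. 4 * (x $ a * x $ a) * pd j (pd j B) x) x = pd a (\<lambda>x. - 3 * b x) x"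
      by (rule dir_deriv_cong[OF oV x]) (rule s6)
    then have "8 * x $ a * pd j (pd j B) x + 4 * (x $ a * x $ a) * pd j (pd j (pd a b)) x = - 3 * pd a b x"
      by (simp add: dir_deriv_mult[OF _ _ x] dir_deriv_uminus[OF _ x] dir_deriv_const sm Sb pj Bb[OF x] algebra_simps)
    then show ?thesis using s6[OF x] s5[OF x] s2[OF x] by algebra
  qed
  \<comment> \<open>The relation with -15 is differentiated along \<open>x\<^sub>a\<close>;
    replacing the derivatives of \<open>b\<close> along \<open>x\<^sub>a\<close> by
    \<open>s5\<close> and \<open>s2\<close> turns it into the relation with 5, and the two are
    compatible only for \<open>b = 0\<close>.\<close>
  have "pd a (\<lambda>x. 4 * (x $ a * x $ a) * pd j (pd j b) x) x = pd a (\<lambda>x. - 15 * b x) x"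
    by (rule dir_deriv_cong[OF oV x]) (rule s8)
  then have "8 * x $ a * pd j (pd j b) x + 4 * (x $ a * x $ a) * pd j (pd j (pd a b)) x = - 15 * pd a b x"
    by (simp add: dir_deriv_mult[OF _ _ x] dir_deriv_uminus[OF _ x] dir_deriv_const sm Sb pj dir_deriv_commute3[OF oV Sb x, of "axis a 1"] algebra_simps)
  then have "b x = 0" using s8[OF x] s5[OF x] s2[OF x] by algebra
  then show ?thesis by (simp add: b_def)
qed

section \<open>Structure of an arbitrary integral\<close>

lemma has_derivative_slice:
  assumes "(F has_derivative D) (at (x, p))"
  shows "((\<lambda>x. F (x, p)) has_derivative (\<lambda>v. D (v, 0))) (at x)"
    and "((\<lambda>p. F (x, p)) has_derivative (\<lambda>w. D (0, w))) (at p)"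
proof -
  have "((\<lambda>x. (x, p)) has_derivative (\<lambda>v. (v, 0))) (at x)"
    "((\<lambda>p. (x, p)) has_derivative (\<lambda>w. (0, w))) (at p)"
    by (auto intro!: derivative_eq_intros)
  from diff_chain_at[OF this(1) assms] diff_chain_at[OF this(2) assms]
  show "((\<lambda>x. F (x, p)) has_derivative (\<lambda>v. D (v, 0))) (at x)"
    "((\<lambda>p. F (x, p)) has_derivative (\<lambda>w. D (0, w))) (at p)"
    by (simp_all add: o_def)
qed

text \<open>The induction varies \<open>F\<close> because a derivative of a slice is the slice of
  the derivative of \<open>F\<close> in a direction \<open>(v, 0)\<close>.\<close>

lemma Ck_on_slice:
  assumes "open S" "Ck_on k (S \<times> UNIV) F"
  shows "Ck_on k S (\<lambda>x. F (x, p))"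
  using assms(2)
proof (induction k arbitrary: F)
  case 0
  have "continuous_on S (F \<circ> (\<lambda>x. (x, p)))"
    using 0 by (intro continuous_on_compose continuous_intros) (auto elim!: continuous_on_subset)
  then show ?case by (simp add: o_def)
next
  case (Suc k)
  have D: "((\<lambda>x. F (x, p)) has_derivative (\<lambda>v. frechet_derivative F (at (x, p)) (v, 0))) (at x)"
    if "x \<in> S" for x
    using Suc.prems that by (intro has_derivative_slice(1)) (auto simp: frechet_derivative_works[symmetric])
  have D': "frechet_derivative F (at (x, p)) (v, 0) = frechet_derivative (\<lambda>x. F (x, p)) (at x) v"
    if "x \<in> S" for x v
    using frechet_derivative_at[OF D[OF that], symmetric] by simp
  have "Ck_on k S (\<lambda>x. frechet_derivative F (at (x, p)) (v, 0))" for v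
    using Suc.IH[of "\<lambda>z. frechet_derivative F (at z) (v, 0)"] Suc.prems by simp
  then have "Ck_on k S (\<lambda>x. frechet_derivative (\<lambda>x. F (x, p)) (at x) v)" for v
    by (rule Ck_on_cong[OF assms(1) D', rotated])
  then show ?case using D by (auto simp: differentiable_def)
qed

lemma smooth_on_slice:
  "open S \<Longrightarrow> smooth_on (S \<times> UNIV) F \<Longrightarrow> smooth_on S (\<lambda>x. F (x, p))"
  by (simp add: smooth_on_def Ck_on_slice)

lemma dir_deriv_slices:
  assumes "smooth_on S F" "(x, p) \<in> S"
  shows "dir_deriv (v, w) F (x, p) = dir_deriv v (\<lambda>x. F (x, p)) x + dir_deriv w (\<lambda>p. F (x, p)) p"
proof -
  have D: "(F has_derivative (\<lambda>v. dir_deriv v F (x, p))) (at (x, p))"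
    using assms by (rule has_derivative_dir_deriv)
  have "dir_deriv ((v, 0) + (0, w)) F (x, p) = dir_deriv (v, 0) F (x, p) + dir_deriv (0, w) F (x, p)"
    by (rule linear_add[OF has_derivative_linear[OF D]])
  then show ?thesis
    using dir_deriv_eqI[OF has_derivative_slice(1)[OF D]] dir_deriv_eqI[OF has_derivative_slice(2)[OF D]] by simp
qed

lemma dir_deriv_quadratic_form:
  fixes u :: "'n::finite \<Rightarrow> 'n \<Rightarrow> real"
  assumes sym: "\<And>k l. u k l = u l k"
  shows "dir_deriv w (\<lambda>p::real^'n. \<Sum>k\<in>UNIV. \<Sum>l\<in>UNIV. u k l * (p $ k * p $ l)) p =
    2 * (\<Sum>k\<in>UNIV. \<Sum>l\<in>UNIV. u k l * (w $ k * p $ l))"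
proof -
  have "((\<lambda>p::real^'n. \<Sum>k\<in>UNIV. \<Sum>l\<in>UNIV. u k l * (p $ k * p $ l)) has_derivative
      (\<lambda>w. \<Sum>k\<in>UNIV. \<Sum>l\<in>UNIV. u k l * (p $ k * w $ l + w $ k * p $ l))) (at p)"
    by (intro has_derivative_sum has_derivative_mult_right has_derivative_mult
        bounded_linear_imp_has_derivative bounded_linear_vec_nth)
  from dir_deriv_eqI[OF this, of w]
  have "dir_deriv w (\<lambda>p::real^'n. \<Sum>k\<in>UNIV. \<Sum>l\<in>UNIV. u k l * (p $ k * p $ l)) p =
      (\<Sum>k\<in>UNIV. \<Sum>l\<in>UNIV. u k l * (p $ k * w $ l)) + (\<Sum>k\<in>UNIV. \<Sum>l\<in>UNIV. u k l * (w $ k * p $ l))"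
    by (simp add: distrib_left sum.distrib)
  moreover have "(\<Sum>k\<in>UNIV. \<Sum>l\<in>UNIV. u k l * (p $ k * w $ l)) = (\<Sum>k\<in>UNIV. \<Sum>l\<in>UNIV. u k l * (w $ k * p $ l))"
    by (subst sum.swap) (simp add: sym mult.commute)
  ultimately show ?thesis by simp
qed

text \<open>The definition of an integral supplies coefficients pointwise, with neither smoothness
  nor symmetry. Polarizing \<open>F\<close> at sums of two basis momenta provides both, since slices
  of \<open>F\<close> are smooth. The final clause is the Killing equation of the metric in these
  coefficients.\<close>

lemma quadratic_integral_components:
  fixes V :: "(real^'n::finite) set"
  assumes V: "open V" "V \<subseteq> {x. 0 < x $ a}"
    and F: "F \<in> quadratic_integrals V (affine_metric a)"
  obtains u :: "'n \<Rightarrow> 'n \<Rightarrow> real^'n \<Rightarrow> real" where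
    "\<And>k l. smooth_on V (u k l)" "\<And>k l. u k l = u l k"
    "\<And>x p. x \<in> V \<Longrightarrow> F (x, p) = (\<Sum>k\<in>UNIV. \<Sum>l\<in>UNIV. u k l x * (p $ k * p $ l))"
    "\<And>i k l x. x \<in> V \<Longrightarrow> x $ a * (pd i (u k l) x + pd k (u l i) x + pd l (u i k) x) +
      ((if i = k then u a l x else 0) + (if k = l then u a i x else 0) + (if l = i then u a k x else 0)) = 0"
proof
  define u where "u k l x = (F (x, axis k 1 + axis l 1) - F (x, axis k 1) - F (x, axis l 1)) * (1/2)" for k l x
  have S: "smooth_on (V \<times> UNIV) F" using F by (simp add: quadratic_integrals_def)
  note sl = smooth_on_slice[OF V(1) S]
  show Su: "smooth_on V (u k l)" for k l
    unfolding u_def[abs_def] by (intro smooth_on_mult smooth_on_minus smooth_on_const sl V(1))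
  show sym: "u k l = u l k" for k l by (auto simp: u_def fun_eq_iff add.commute)
  obtain w :: "real^'n \<Rightarrow> real^'n^'n" where
    w: "\<And>x p. x \<in> V \<Longrightarrow> F (x, p) = (\<Sum>k\<in>UNIV. \<Sum>l\<in>UNIV. w x $ k $ l * p $ k * p $ l)"
    using F by (auto simp: quadratic_integrals_def)
  show Fu: "F (x, p) = (\<Sum>k\<in>UNIV. \<Sum>l\<in>UNIV. u k l x * (p $ k * p $ l))" if x: "x \<in> V" for x p
  proof -
    let ?B = "\<lambda>p q. \<Sum>k\<in>UNIV. \<Sum>l\<in>UNIV. w x $ k $ l * p $ k * q $ l"
    have B: "bilinear ?B"
      by (auto simp: bilinear_def linear_iff algebra_simps sum.distrib sum_distrib_left)
    have FB: "F (x, p) = ?B p p" for p by (rule w[OF x])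
    have uB: "u k l x = (?B (axis k 1) (axis l 1) + ?B (axis l 1) (axis k 1)) * (1/2)" for k l
      unfolding u_def FB bilinear_ladd[OF B] bilinear_radd[OF B] by simp
    define b where "b k l = ?B (axis k 1) (axis l 1)" for k l
    have "(\<Sum>k\<in>UNIV. \<Sum>l\<in>UNIV. b l k * (p $ k * p $ l)) = (\<Sum>k\<in>UNIV. \<Sum>l\<in>UNIV. b k l * (p $ k * p $ l))"
      by (subst sum.swap) (simp add: mult_ac)
    moreover have "?B p p = (\<Sum>k\<in>UNIV. \<Sum>l\<in>UNIV. b k l * (p $ k * p $ l))"
      unfolding b_def by (subst bilinear_form_expansion[OF B, of p p]) (simp only: mult.assoc)
    moreover have "(\<Sum>k\<in>UNIV. \<Sum>l\<in>UNIV. u k l x * (p $ k * p $ l)) =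
      ((\<Sum>k\<in>UNIV. \<Sum>l\<in>UNIV. b k l * (p $ k * p $ l)) + (\<Sum>k\<in>UNIV. \<Sum>l\<in>UNIV. b l k * (p $ k * p $ l))) * (1/2)"
      unfolding uB b_def[symmetric] sum_distrib_right sum.distrib[symmetric]
      by (intro sum.cong refl) (simp add: field_simps)
    ultimately show ?thesis by (simp add: FB)
  qed
  fix i k l x assume x: "x \<in> V"
  have xa: "x $ a > 0" using V x by auto
  \<comment> \<open>The coefficients of \<open>(x\<^sub>a)\<^sup>2\<close> times the derivative of
    \<open>F\<close> along the flow, a cubic form in the momenta. They are not symmetric; the
    symmetrization doubles each term of the Killing equation.\<close>
  let ?T = "\<lambda>i k l. x $ a * pd i (u k l) x + (if i = k then u a l x else 0)"
  have "(\<Sum>i\<in>UNIV. \<Sum>k\<in>UNIV. \<Sum>l\<in>UNIV. ?T i k l * (p $ i * p $ k * p $ l)) = 0" for p :: "real^'n"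
  proof -
    have xp: "(x, p) \<in> V \<times> UNIV" using x by simp
    have "poisson_bracket (geodesic_hamiltonian (affine_metric a)) F (x, p) = 0"
      using F xp by (auto simp: quadratic_integrals_def)
    then have "dir_deriv (geodesic_field a (x, p)) F (x, p) = 0"
      using poisson_bracket_affine_metric[OF V x smooth_on_imp_differentiable[OF S xp]] by simp
    then have 0: "dir_deriv ((1 / x $ a) *\<^sub>R p) (\<lambda>x. F (x, p)) x
        + dir_deriv (((p \<bullet> p) / (2 * (x $ a)^2)) *\<^sub>R axis a 1) (\<lambda>p. F (x, p)) p = 0"
      using dir_deriv_slices[OF S xp] by (simp add: geodesic_field_def)
    have A: "dir_deriv ((1 / x $ a) *\<^sub>R p) (\<lambda>x. F (x, p)) x =
        (1 / x $ a) * (\<Sum>i\<in>UNIV. \<Sum>k\<in>UNIV. \<Sum>l\<in>UNIV. pd i (u k l) x * (p $ i * p $ k * p $ l))"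
    proof -
      have pdF: "pd i (\<lambda>x. F (x, p)) x = (\<Sum>k\<in>UNIV. \<Sum>l\<in>UNIV. (p $ k * p $ l) * pd i (u k l) x)" for i
      proof -
        have "pd i (\<lambda>x. F (x, p)) x = pd i (\<lambda>x. \<Sum>k\<in>UNIV. \<Sum>l\<in>UNIV. (p $ k * p $ l) * u k l x) x"
          by (rule dir_deriv_cong[OF V(1) x]) (simp add: Fu mult.commute)
        then show ?thesis
          by (simp add: dir_deriv_sum[OF V(1) _ x] dir_deriv_cmult[OF _ x] smooth_on_sum smooth_on_mult smooth_on_const Su V(1))
      qed
      show ?thesis
        unfolding dir_deriv_eq_sum_pd[OF sl x, of "(1 / x $ a) *\<^sub>R p"] pdF sum_distrib_left
        by (intro sum.cong refl) (simp add: mult_ac)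
    qed
    have Fp: "(\<lambda>p. F (x, p)) = (\<lambda>p. \<Sum>k\<in>UNIV. \<Sum>l\<in>UNIV. u k l x * (p $ k * p $ l))" using Fu[OF x] by auto
    have "dir_deriv (((p \<bullet> p) / (2 * (x $ a)^2)) *\<^sub>R axis a 1) (\<lambda>p. F (x, p)) p =
        2 * (\<Sum>k\<in>UNIV. \<Sum>l\<in>UNIV. u k l x * ((((p \<bullet> p) / (2 * (x $ a)^2)) *\<^sub>R axis a 1) $ k * p $ l))"
      unfolding Fp by (rule dir_deriv_quadratic_form) (rule fun_cong[OF sym])
    also have "\<dots> = 2 * (\<Sum>l\<in>UNIV. u a l x * ((p \<bullet> p) / (2 * (x $ a)^2) * p $ l))"
      by (subst sum.swap) (simp add: axis_def if_distrib if_distribR cong: if_cong)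
    also have "\<dots> = (1 / (x $ a)^2) * ((p \<bullet> p) * (\<Sum>l\<in>UNIV. u a l x * p $ l))"
      by (simp add: sum_distrib_left mult_ac)
    also have "(p \<bullet> p) * (\<Sum>l\<in>UNIV. u a l x * p $ l) =
      (\<Sum>i\<in>UNIV. \<Sum>k\<in>UNIV. \<Sum>l\<in>UNIV. (if i = k then u a l x else 0) * (p $ i * p $ k * p $ l))"
    proof -
      have "(\<Sum>l\<in>UNIV. (if i = k then u a l x else 0) * (p $ i * p $ k * p $ l)) =
          (if i = k then (p $ i * p $ i) * (\<Sum>l\<in>UNIV. u a l x * p $ l) else 0)" for i k
        by (simp add: sum_distrib_left mult_ac)
      then show ?thesis by (simp add: inner_vec_def sum_distrib_right)
    qed
    finally have B: "dir_deriv (((p \<bullet> p) / (2 * (x $ a)^2)) *\<^sub>R axis a 1) (\<lambda>p. F (x, p)) p = (1 / (x $ a)^2) *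
      (\<Sum>i\<in>UNIV. \<Sum>k\<in>UNIV. \<Sum>l\<in>UNIV. (if i = k then u a l x else 0) * (p $ i * p $ k * p $ l))" .
    have "(\<Sum>i\<in>UNIV. \<Sum>k\<in>UNIV. \<Sum>l\<in>UNIV. ?T i k l * (p $ i * p $ k * p $ l)) =
        x $ a * (\<Sum>i\<in>UNIV. \<Sum>k\<in>UNIV. \<Sum>l\<in>UNIV. pd i (u k l) x * (p $ i * p $ k * p $ l)) +
        (\<Sum>i\<in>UNIV. \<Sum>k\<in>UNIV. \<Sum>l\<in>UNIV. (if i = k then u a l x else 0) * (p $ i * p $ k * p $ l))"
      unfolding distrib_right sum.distrib sum_distrib_left by (simp only: mult.assoc)
    also have "\<dots> = (x $ a)^2 * (dir_deriv ((1 / x $ a) *\<^sub>R p) (\<lambda>x. F (x, p)) x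
        + dir_deriv (((p \<bullet> p) / (2 * (x $ a)^2)) *\<^sub>R axis a 1) (\<lambda>p. F (x, p)) p)"
      unfolding A B distrib_left using xa by (simp add: power2_eq_square)
    finally show ?thesis using 0 by simp
  qed
  from cubic_form_zero[of ?T, OF this, of i k l]
  show "x $ a * (pd i (u k l) x + pd k (u l i) x + pd l (u i k) x) +
      ((if i = k then u a l x else 0) + (if k = l then u a i x else 0) + (if l = i then u a k x else 0)) = 0"
    using sym[of k l] sym[of l i] sym[of i k] by (auto simp: algebra_simps split: if_splits)
qed

text \<open>Separation of \<open>x\<^sub>a\<close> from the other variables. Once
  \<open>u\<^sub>a\<^sub>j\<close> is known from \<open>f\<close>, the equations with one index
  \<open>a\<close> say that \<open>K\<close> does not depend on \<open>x\<^sub>a\<close>, and those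
  without index \<open>a\<close> equate the Killing operator of \<open>K\<close> to a multiple of
  \<open>x\<^sub>a\<close> times third derivatives of \<open>f\<close>. Since neither factor
  involves \<open>x\<^sub>a\<close>, both sides vanish.\<close>

lemma integral_components_structure:
  fixes V :: "(real^'n::finite) set" and u :: "'n \<Rightarrow> 'n \<Rightarrow> real^'n \<Rightarrow> real"
  assumes V: "open V" "V \<subseteq> {x. 0 < x $ a}"
    and S: "\<And>k l. smooth_on V (u k l)" and sym: "\<And>k l. u k l = u l k"
    and pde: "\<And>i k l x. x \<in> V \<Longrightarrow> x $ a * (pd i (u k l) x + pd k (u l i) x + pd l (u i k) x) +
      ((if i = k then u a l x else 0) + (if k = l then u a i x else 0) + (if l = i then u a k x else 0)) = 0"
  obtains f and K :: "'n \<Rightarrow> 'n \<Rightarrow> real^'n \<Rightarrow> real" where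
    "smooth_on V f" "\<And>x. x \<in> V \<Longrightarrow> pd a f x = 0"
    "\<And>i j k x. x \<in> V \<Longrightarrow> pd i (pd j (pd k f)) x = 0"
    "\<And>k l. smooth_on V (K k l)" "\<And>k l. K k l = K l k" "\<And>l. K a l = (\<lambda>x. 0)"
    "\<And>k l x. x \<in> V \<Longrightarrow> pd a (K k l) x = 0"
    "\<And>i k l x. x \<in> V \<Longrightarrow> pd i (K k l) x + pd k (K l i) x + pd l (K i k) x = 0"
    "\<And>k l x. x \<in> V \<Longrightarrow> u k l x = K k l x + 2 * x $ a * pd k (pd l f) x
      - (if k = a then pd l f x else 0) - (if l = a then pd k f x else 0) + (if k = l then f x / x $ a else 0)"
proof
  define f where "f x = x $ a * u a a x" for x
  \<comment> \<open>What remains of \<open>u\<close> after removing the part generated by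
    \<open>f\<close>. Both orders of the mixed derivative occur so that \<open>K\<close> is
    symmetric as a total function, also off \<open>V\<close> where the derivatives may fail to
    commute.\<close>
  define K where "K k l = (if k = a \<or> l = a then (\<lambda>x. 0) else
      (\<lambda>x. u k l x - (if k = l then 1 else 0) * u a a x - x $ a * (pd k (pd l f) x + pd l (pd k f) x)))" for k l
  note oV = V(1)
  have pos: "x $ a > 0" if "x \<in> V" for x using V that by auto
  note sm = smooth_on_add smooth_on_minus smooth_on_mult smooth_on_const smooth_on_nth smooth_on_dir_deriv S oV
  show Sf: "smooth_on V f" unfolding f_def[abs_def] by (intro sm)
  show SK: "smooth_on V (K k l)" for k l
    unfolding K_def by (auto intro!: sm Sf)
  show symK: "K k l = K l k" for k l by (auto simp: K_def sym[of k l] fun_eq_iff)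
  show Ka: "K a l = (\<lambda>x. 0)" for l by (simp add: K_def)
  have e0: "x $ a * pd a (u a a) x = - u a a x" if "x \<in> V" for x
    using pde[OF that, of a a a] by simp
  have ua: "u a j x = - x $ a * pd j (u a a) x" if j: "j \<noteq> a" and x: "x \<in> V" for j x
  proof (rule planar_system[where A = "u a a" and C = "u j j", OF V j S S S e0 _ _ _ x])
    fix x assume x: "x \<in> V"
    show "x $ a * (2 * pd a (u a j) x + pd j (u a a) x) = - u a j x"
      using pde[OF x, of a a j] j by (simp add: sym[of j a] algebra_simps)
    show "x $ a * (pd a (u j j) x + 2 * pd j (u a j) x) = - u a a x"
      using pde[OF x, of a j j] j by (simp add: sym[of j a] algebra_simps)
    show "x $ a * pd j (u j j) x = - u a j x"
      using pde[OF x, of j j j] by simp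
  qed
  show fa: "pd a f x = 0" if x: "x \<in> V" for x
    using e0[OF x] unfolding f_def[abs_def] by (simp add: dir_deriv_mult[OF _ _ x] sm pd_nth)
  have fj: "pd j f x = - u a j x" if j: "j \<noteq> a" and x: "x \<in> V" for j x
    using ua[OF j x] j unfolding f_def[abs_def] by (simp add: dir_deriv_mult[OF _ _ x] sm pd_nth)
  have faj: "pd a (pd j f) x = 0" if x: "x \<in> V" for j x
  proof -
    have "pd a (pd j f) x = pd j (pd a f) x" by (rule dir_deriv_commute[OF oV Sf x])
    also have "\<dots> = pd j (\<lambda>x. 0) x" by (rule dir_deriv_cong[OF oV x]) (rule fa)
    finally show ?thesis by (simp add: dir_deriv_const)
  qed
  have fajk: "pd a (pd j (pd k f)) x = 0" if x: "x \<in> V" for j k x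
  proof -
    have "pd a (pd j (pd k f)) x = pd j (pd a (pd k f)) x" by (intro dir_deriv_commute[OF oV _ x] sm Sf)
    also have "\<dots> = pd j (\<lambda>x. 0) x" by (rule dir_deriv_cong[OF oV x]) (rule faj)
    finally show ?thesis by (simp add: dir_deriv_const)
  qed
  have fajkl: "pd a (pd i (pd j (pd k f))) x = 0" if x: "x \<in> V" for i j k x
  proof -
    have "pd a (pd i (pd j (pd k f))) x = pd i (pd a (pd j (pd k f))) x" by (intro dir_deriv_commute[OF oV _ x] sm Sf)
    also have "\<dots> = pd i (\<lambda>x. 0) x" by (rule dir_deriv_cong[OF oV x]) (rule fajk)
    finally show ?thesis by (simp add: dir_deriv_const)
  qed
  have fsym: "pd k (pd l f) x = pd l (pd k f) x" if "x \<in> V" for k l x by (rule dir_deriv_commute[OF oV Sf that])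
  have pdK: "pd i (K k l) x = pd i (u k l) x - (if k = l then 1 else 0) * pd i (u a a) x
      - (x $ a * (pd i (pd k (pd l f)) x + pd i (pd l (pd k f)) x)
        + (if i = a then 1 else 0) * (pd k (pd l f) x + pd l (pd k f) x))"
    if x: "x \<in> V" and "k \<noteq> a" "l \<noteq> a" for i k l x
    using that(2,3) unfolding K_def
    by (simp add: dir_deriv_minus[OF _ _ x] dir_deriv_add[OF _ _ x] dir_deriv_mult[OF _ _ x] dir_deriv_const sm Sf pd_nth)
  show aK: "pd a (K k l) x = 0" if x: "x \<in> V" for k l x
  proof (cases "k = a \<or> l = a")
    case True then show ?thesis by (auto simp: K_def dir_deriv_const)
  next
    case False
    then have kl: "k \<noteq> a" "l \<noteq> a" by auto
    have pu: "pd k (u a l) x = - pd k (pd l f) x" if "l \<noteq> a" for k l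
    proof -
      have "pd k (u a l) x = pd k (\<lambda>x. - pd l f x) x"
        by (rule dir_deriv_cong[OF oV x]) (simp add: fj[OF that])
      then show ?thesis by (simp add: dir_deriv_uminus[OF _ x] sm Sf)
    qed
    have "x $ a * (pd a (u k l) x - pd k (pd l f) x - pd l (pd k f) x) = - (if k = l then u a a x else 0)"
      using pde[OF x, of a k l] kl pu[OF kl(1), of l] pu[OF kl(2), of k] by (auto simp: sym[of l a])
    moreover have "x $ a * ((if k = l then 1 else 0) * pd a (u a a) x) = - (if k = l then u a a x else 0)"
      using e0[OF x] by simp
    ultimately have "x $ a * pd a (K k l) x = 0"
      unfolding pdK[OF x kl] fajk[OF x] by (simp add: algebra_simps)
    then show ?thesis using pos[OF x] by simp
  qed
  have cycK: "pd i (K k l) x + pd k (K l i) x + pd l (K i k) x = - 6 * x $ a * pd i (pd k (pd l f)) x"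
    if x: "x \<in> V" and ikl: "i \<noteq> a" "k \<noteq> a" "l \<noteq> a" for i k l x
  proof -
    have perm: "pd i (pd l (pd k f)) x = pd i (pd k (pd l f)) x" "pd k (pd l (pd i f)) x = pd i (pd k (pd l f)) x"
      "pd k (pd i (pd l f)) x = pd i (pd k (pd l f)) x" "pd l (pd i (pd k f)) x = pd i (pd k (pd l f)) x"
      "pd l (pd k (pd i f)) x = pd i (pd k (pd l f)) x"
    proof -
      show 1: "pd i (pd l (pd k f)) x = pd i (pd k (pd l f)) x"
        by (rule dir_deriv_cong[OF oV x]) (rule fsym)
      show "pd k (pd l (pd i f)) x = pd i (pd k (pd l f)) x" by (rule dir_deriv_commute3[OF oV Sf x, symmetric])
      show "pd k (pd i (pd l f)) x = pd i (pd k (pd l f)) x" by (intro dir_deriv_commute[OF oV _ x] sm Sf)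
      show "pd l (pd i (pd k f)) x = pd i (pd k (pd l f)) x" by (rule dir_deriv_commute3[OF oV Sf x])
      show "pd l (pd k (pd i f)) x = pd i (pd k (pd l f)) x"
        unfolding 1[symmetric] by (rule dir_deriv_commute3[OF oV Sf x, symmetric])
    qed
    \<comment> \<open>The derivatives of \<open>u\<^sub>a\<^sub>a\<close> cancel against the
      diagonal terms of the Killing equation, by \<open>ua\<close>. Each of the three
      \<open>K\<close> leaves two equal third derivatives of \<open>f\<close>, whence the 6.\<close>
    have "x $ a * (pd i (K k l) x + pd k (K l i) x + pd l (K i k) x) = x $ a * (- 6 * x $ a * pd i (pd k (pd l f)) x)"
      using pde[OF x, of i k l] ua[OF ikl(1) x] ua[OF ikl(2) x] ua[OF ikl(3) x] ikl
      by (simp add: pdK[OF x] perm algebra_simps split: if_splits)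
    moreover have "x $ a \<noteq> 0" using pos[OF x] by simp
    ultimately show ?thesis using mult_left_cancel by blast
  qed
  \<comment> \<open>Differentiating \<open>cycK\<close> along \<open>x\<^sub>a\<close> annihilates
    the left side and every factor on the right except \<open>x\<^sub>a\<close> itself.\<close>
  have third: "pd i (pd k (pd l f)) x = 0" if x: "x \<in> V" and ikl: "i \<noteq> a" "k \<noteq> a" "l \<noteq> a" for i k l x
  proof -
    have aiK: "pd a (pd i (K k l)) x = 0" for i k l
    proof -
      have "pd a (pd i (K k l)) x = pd i (pd a (K k l)) x" by (rule dir_deriv_commute[OF oV SK x])
      also have "\<dots> = pd i (\<lambda>x. 0) x" by (rule dir_deriv_cong[OF oV x]) (rule aK)
      finally show ?thesis by (simp add: dir_deriv_const)
    qed
    have "pd a (\<lambda>x. pd i (K k l) x + pd k (K l i) x + pd l (K i k) x) x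
        = pd a (\<lambda>x. - 6 * x $ a * pd i (pd k (pd l f)) x) x"
      by (rule dir_deriv_cong[OF oV x]) (rule cycK[OF _ ikl])
    then show ?thesis
      by (simp add: dir_deriv_add[OF _ _ x] dir_deriv_mult[OF _ _ x] dir_deriv_uminus[OF _ x] dir_deriv_const sm Sf SK pd_nth aiK fajkl[OF x])
  qed
  show third': "pd i (pd k (pd l f)) x = 0" if x: "x \<in> V" for i k l x
  proof -
    have "pd i (pd k (pd a f)) x = pd a (pd i (pd k f)) x" by (rule dir_deriv_commute3[OF oV Sf x, symmetric])
    moreover have "pd i (pd a (pd l f)) x = pd a (pd i (pd l f)) x" by (intro dir_deriv_commute[OF oV _ x] sm Sf)
    ultimately show ?thesis using fajk[OF x] third[OF x, of i k l] by metis
  qed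
  show "pd i (K k l) x + pd k (K l i) x + pd l (K i k) x = 0" if x: "x \<in> V" for i k l x
  proof (cases "i = a \<or> k = a \<or> l = a")
    case True
    have Ka': "K l a = (\<lambda>x. 0)" for l using Ka[of l] symK[of l a] by simp
    show ?thesis using True by (auto simp: Ka Ka' dir_deriv_const aK[OF x])
  next
    case False
    then show ?thesis using cycK[OF x, of i k l] third'[OF x] by simp
  qed
  show "u k l x = K k l x + 2 * x $ a * pd k (pd l f) x
      - (if k = a then pd l f x else 0) - (if l = a then pd k f x else 0) + (if k = l then f x / x $ a else 0)"
    if x: "x \<in> V" for k l x
  proof -
    have fx: "f x / x $ a = u a a x" using pos[OF x] by (simp add: f_def)
    have ka: "pd k (pd a f) x = 0" for k using fsym[OF x, of k a] faj[OF x] by simp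
    show ?thesis
      using fj[OF _ x, of k] fj[OF _ x, of l] fsym[OF x, of k l]
      by (auto simp: K_def fx ka faj[OF x] fa[OF x] sym[of k a])
  qed
qed

section \<open>Spanning and the dimension\<close>

lemma sum3_swap13: "(\<Sum>i\<in>A. \<Sum>j\<in>B. \<Sum>k\<in>C. g i j k) = (\<Sum>k\<in>C. \<Sum>j\<in>B. \<Sum>i\<in>A. g i j k)"
  for g :: "'a \<Rightarrow> 'b \<Rightarrow> 'c \<Rightarrow> real"
proof -
  have "(\<Sum>i\<in>A. \<Sum>j\<in>B. \<Sum>k\<in>C. g i j k) = (\<Sum>j\<in>B. \<Sum>i\<in>A. \<Sum>k\<in>C. g i j k)" by (rule sum.swap)
  also have "\<dots> = (\<Sum>j\<in>B. \<Sum>k\<in>C. \<Sum>i\<in>A. g i j k)" by (intro sum.cong refl sum.swap)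
  also have "\<dots> = (\<Sum>k\<in>C. \<Sum>j\<in>B. \<Sum>i\<in>A. g i j k)" by (rule sum.swap)
  finally show ?thesis .
qed

text \<open>By the cyclic identity, exchanging \<open>i\<close> and \<open>k\<close> in the monomial
  multiplies the sum by -1/2, so the antisymmetrized sum is 1 + 1/2 times the original.\<close>

lemma sum_pluecker_linear:
  fixes S :: "'n::finite \<Rightarrow> 'n \<Rightarrow> 'n \<Rightarrow> real" and y q :: "'n \<Rightarrow> real"
  assumes sym: "\<And>i k l. S i k l = S i l k" and cyc: "\<And>i k l. S i k l + S k l i + S l i k = 0"
  shows "(\<Sum>i\<in>UNIV. \<Sum>k\<in>UNIV. \<Sum>l\<in>UNIV. S i k l * ((y i * q k - y k * q i) * q l)) =
    3 / 2 * (\<Sum>i\<in>UNIV. \<Sum>k\<in>UNIV. \<Sum>l\<in>UNIV. S i k l * (y i * q k * q l))"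
proof -
  let ?G = "\<lambda>S. \<Sum>i\<in>UNIV. \<Sum>k\<in>UNIV. \<Sum>l\<in>UNIV. S i k l * (y i * q k * q l)"
  have "(\<Sum>i\<in>UNIV. \<Sum>k\<in>UNIV. \<Sum>l\<in>UNIV. S i k l * (y k * q i * q l)) = ?G (\<lambda>i k l. S k i l)"
    by (rule sum.swap)
  moreover have "(\<Sum>k\<in>UNIV. \<Sum>l\<in>UNIV. S k i l * (y i * q k * q l)) =
      (\<Sum>k\<in>UNIV. \<Sum>l\<in>UNIV. S l i k * (y i * q k * q l))" for i
    by (subst sum.swap) (simp add: mult_ac)
  then have "?G (\<lambda>i k l. S k i l) = ?G (\<lambda>i k l. S l i k)" by simp
  moreover have "?G S + ?G (\<lambda>i k l. S k i l) + ?G (\<lambda>i k l. S l i k) = 0"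
    unfolding sum.distrib[symmetric] distrib_right[symmetric]
  proof (intro sum.neutral ballI)
    fix i k l
    have "S i k l + S k i l + S l i k = 0" using cyc[of i k l] sym[of k i l] by simp
    then show "(S i k l + S k i l + S l i k) * (y i * q k * q l) = 0" by simp
  qed
  moreover have "(\<Sum>i\<in>UNIV. \<Sum>k\<in>UNIV. \<Sum>l\<in>UNIV. S i k l * ((y i * q k - y k * q i) * q l)) =
      ?G S - (\<Sum>i\<in>UNIV. \<Sum>k\<in>UNIV. \<Sum>l\<in>UNIV. S i k l * (y k * q i * q l))"
    unfolding sum_subtractf[symmetric] by (simp add: algebra_simps)
  ultimately show ?thesis by simp
qed

text \<open>The product of minors expands into four sums: the original, two that enter as +1/2 of it
  by the cyclic identity, and one equal to it by the pair symmetry of \<open>S\<close>. Together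
  they give the factor 3.\<close>

lemma sum_pluecker_quadratic:
  fixes S :: "'n::finite \<Rightarrow> 'n \<Rightarrow> 'n \<Rightarrow> 'n \<Rightarrow> real" and y q :: "'n \<Rightarrow> real"
  assumes sym1: "\<And>i j k l. S i j k l = S j i k l" and sym2: "\<And>i j k l. S i j k l = S i j l k"
    and cyc: "\<And>i j k l. S i j k l + S i k l j + S i l j k = 0"
  shows "(\<Sum>i\<in>UNIV. \<Sum>j\<in>UNIV. \<Sum>k\<in>UNIV. \<Sum>l\<in>UNIV.
      S i j k l * ((y i * q k - y k * q i) * (y j * q l - y l * q j))) =
    3 * (\<Sum>i\<in>UNIV. \<Sum>j\<in>UNIV. \<Sum>k\<in>UNIV. \<Sum>l\<in>UNIV. S i j k l * (y i * y j * q k * q l))"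
proof -
  let ?s = "\<lambda>f :: 'n \<Rightarrow> 'n \<Rightarrow> 'n \<Rightarrow> 'n \<Rightarrow> real. \<Sum>i\<in>UNIV. \<Sum>j\<in>UNIV. \<Sum>k\<in>UNIV. \<Sum>l\<in>UNIV. f i j k l"
  let ?G = "\<lambda>S. ?s (\<lambda>i j k l. S i j k l * (y i * y j * q k * q l))"
  have swap24: "?s f = ?s (\<lambda>i j k l. f i l k j)" for f
    by (intro sum.cong refl sum3_swap13)
  have swap34: "?s f = ?s (\<lambda>i j k l. f i j l k)" for f
    by (intro sum.cong refl sum.swap)
  have swap13: "?s f = ?s (\<lambda>i j k l. f k j i l)" for f
    by (rule sum3_swap13)
  \<comment> \<open>The argument known for the pair symmetry of a curvature tensor: the sum of the
    first two cyclic identities minus that of the last two leaves twice the difference of the two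
    sides.\<close>
  have pair: "S i j k l = S k l i j" for i j k l
  proof -
    have "S i j k l + S i k j l + S i l j k = 0" "S i j k l + S j k i l + S j l i k = 0"
      "S i k j l + S j k i l + S k l i j = 0" "S i l j k + S j l i k + S k l i j = 0"
      using cyc[of i j k l] cyc[of j i k l] cyc[of k i j l] cyc[of l i j k]
        sym1[of j i] sym1[of k i] sym1[of k j] sym1[of l i] sym1[of l j] sym1[of l k]
        sym2[of i k l j] sym2[of i l j k] sym2[of i j k l] sym2[of j k l i] sym2[of j l i k]
        sym2[of k j l i] sym2[of k l i j] sym2[of l j k i] sym2[of l k i j]
      by simp_all
    then show ?thesis by linarith
  qed
  have t2: "?s (\<lambda>i j k l. S i j k l * (y i * y l * q k * q j)) = ?G (\<lambda>i j k l. S i l k j)"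
    by (rule swap24)
  have t2': "?G (\<lambda>i j k l. S i l k j) = ?G (\<lambda>i j k l. S i k l j)"
    by (subst swap34) (simp add: mult_ac)
  have t2s: "?G S + ?G (\<lambda>i j k l. S i l k j) + ?G (\<lambda>i j k l. S i k l j) = 0"
    unfolding sum.distrib[symmetric] distrib_right[symmetric]
  proof (intro sum.neutral ballI)
    fix i j k l
    have "S i j k l + S i l k j + S i k l j = 0" using cyc[of i j k l] sym2[of i l k j] by simp
    then show "(S i j k l + S i l k j + S i k l j) * (y i * y j * q k * q l) = 0" by simp
  qed
  have t3: "?s (\<lambda>i j k l. S i j k l * (y k * y j * q i * q l)) = ?G (\<lambda>i j k l. S k j i l)"
    by (subst swap13) (simp add: mult_ac)
  have t3': "?G (\<lambda>i j k l. S k j i l) = ?G (\<lambda>i j k l. S l j i k)"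
    by (subst swap34) (simp add: mult_ac)
  have t3s: "?G S + ?G (\<lambda>i j k l. S k j i l) + ?G (\<lambda>i j k l. S l j i k) = 0"
    unfolding sum.distrib[symmetric] distrib_right[symmetric]
  proof (intro sum.neutral ballI)
    fix i j k l
    have "S i j k l + S k j i l + S l j i k = 0"
      using cyc[of j i k l] sym1[of i j k l] sym1[of k j i l] sym1[of l j i k] sym2[of j k i l] by simp
    then show "(S i j k l + S k j i l + S l j i k) * (y i * y j * q k * q l) = 0" by simp
  qed
  have t4: "?s (\<lambda>i j k l. S i j k l * (y k * y l * q i * q j)) = ?G S"
  proof -
    have "?s (\<lambda>i j k l. S i j k l * (y k * y l * q i * q j)) = ?s (\<lambda>i j k l. S k j i l * (y i * y l * q k * q j))"
      by (rule swap13)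
    also have "\<dots> = ?s (\<lambda>i j k l. S k l i j * (y i * y j * q k * q l))"
      by (rule swap24)
    finally show ?thesis by (simp only: pair[symmetric])
  qed
  have "?s (\<lambda>i j k l. S i j k l * ((y i * q k - y k * q i) * (y j * q l - y l * q j))) =
      ?G S - ?s (\<lambda>i j k l. S i j k l * (y i * y l * q k * q j))
      - ?s (\<lambda>i j k l. S i j k l * (y k * y j * q i * q l)) + ?s (\<lambda>i j k l. S i j k l * (y k * y l * q i * q j))"
    unfolding sum_subtractf[symmetric] sum.distrib[symmetric]
    by (intro sum.cong refl) (simp add: algebra_simps)
  then show ?thesis unfolding t2 t3 t4 using t2' t2s t3' t3s by linarith
qed

text \<open>Terms of degree 0, 1 and 2 in \<open>x\<close> come from two translations, a rotation
  and a translation, and two rotations. The factors 2/3 and 1/3 invert those of the two preceding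
  lemmas. Vanishing at index \<open>a\<close> is what allows replacing \<open>hom_coord\<close> and
  \<open>mom_coord\<close> by \<open>x\<close> and \<open>p\<close>.\<close>

lemma killing_form_eq_killing_product_sum:
  fixes a :: "'n::finite"
  assumes d1: "\<And>i k l. d1 i k l = d1 i l k" "\<And>i k l. d1 i k l + d1 k l i + d1 l i k = 0"
    and d2: "\<And>i j k l. d2 i j k l = d2 j i k l" "\<And>i j k l. d2 i j k l = d2 i j l k"
      "\<And>i j k l. d2 i j k l + d2 i k l j + d2 i l j k = 0"
    and z0: "\<And>k l. k = a \<or> l = a \<Longrightarrow> d0 k l = 0"
    and z1: "\<And>i k l. i = a \<or> k = a \<or> l = a \<Longrightarrow> d1 i k l = 0"
    and z2: "\<And>i j k l. i = a \<or> j = a \<or> k = a \<or> l = a \<Longrightarrow> d2 i j k l = 0"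
  shows "(\<Sum>k\<in>UNIV. \<Sum>l\<in>UNIV. (d0 k l + (\<Sum>i\<in>UNIV. d1 i k l * x $ i) +
        (\<Sum>i\<in>UNIV. \<Sum>j\<in>UNIV. d2 i j k l * (x $ i * x $ j))) * (p $ k * p $ l)) =
      (\<Sum>k\<in>UNIV. \<Sum>l\<in>UNIV. d0 k l * killing_product a a k a l (x, p))
      + (\<Sum>i\<in>UNIV. \<Sum>k\<in>UNIV. \<Sum>l\<in>UNIV. (2/3 * d1 i k l) * killing_product a i k a l (x, p))
      + (\<Sum>i\<in>UNIV. \<Sum>j\<in>UNIV. \<Sum>k\<in>UNIV. \<Sum>l\<in>UNIV. (1/3 * d2 i j k l) * killing_product a i k j l (x, p))"
proof -
  have "(\<Sum>k\<in>UNIV. \<Sum>l\<in>UNIV. d0 k l * (p $ k * p $ l)) = (\<Sum>k\<in>UNIV. \<Sum>l\<in>UNIV. d0 k l * killing_product a a k a l (x, p))"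
  proof (intro sum.cong refl)
    fix k l show "d0 k l * (p $ k * p $ l) = d0 k l * killing_product a a k a l (x, p)"
      using z0[of k l] by (cases "k = a \<or> l = a") (auto simp: killing_product_def killing_field_def hom_coord_def mom_coord_def)
  qed
  moreover have "(\<Sum>k\<in>UNIV. \<Sum>l\<in>UNIV. (\<Sum>i\<in>UNIV. d1 i k l * x $ i) * (p $ k * p $ l)) =
      (\<Sum>i\<in>UNIV. \<Sum>k\<in>UNIV. \<Sum>l\<in>UNIV. (2/3 * d1 i k l) * killing_product a i k a l (x, p))"
  proof -
    have "(2/3 * d1 i k l) * killing_product a i k a l (x, p) =
        2/3 * (d1 i k l * ((x $ i * p $ k - x $ k * p $ i) * p $ l))" for i k l
      using z1[of i k l] by (cases "i = a \<or> k = a \<or> l = a") (auto simp: killing_product_def killing_field_def hom_coord_def mom_coord_def)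
    then have "(\<Sum>i\<in>UNIV. \<Sum>k\<in>UNIV. \<Sum>l\<in>UNIV. (2/3 * d1 i k l) * killing_product a i k a l (x, p)) =
        2/3 * (\<Sum>i\<in>UNIV. \<Sum>k\<in>UNIV. \<Sum>l\<in>UNIV. d1 i k l * ((x $ i * p $ k - x $ k * p $ i) * p $ l))"
      by (simp only: sum_distrib_left)
    also have "\<dots> = (\<Sum>i\<in>UNIV. \<Sum>k\<in>UNIV. \<Sum>l\<in>UNIV. d1 i k l * (x $ i * p $ k * p $ l))"
      using sum_pluecker_linear[of d1 "\<lambda>i. x $ i" "\<lambda>i. p $ i", OF d1] by simp
    also have "\<dots> = (\<Sum>k\<in>UNIV. \<Sum>i\<in>UNIV. \<Sum>l\<in>UNIV. d1 i k l * (x $ i * p $ k * p $ l))" by (rule sum.swap)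
    also have "\<dots> = (\<Sum>k\<in>UNIV. \<Sum>l\<in>UNIV. \<Sum>i\<in>UNIV. d1 i k l * (x $ i * p $ k * p $ l))"
      by (intro sum.cong refl sum.swap)
    finally show ?thesis by (simp only: sum_distrib_right mult.assoc)
  qed
  moreover have "(\<Sum>k\<in>UNIV. \<Sum>l\<in>UNIV. (\<Sum>i\<in>UNIV. \<Sum>j\<in>UNIV. d2 i j k l * (x $ i * x $ j)) * (p $ k * p $ l)) =
      (\<Sum>i\<in>UNIV. \<Sum>j\<in>UNIV. \<Sum>k\<in>UNIV. \<Sum>l\<in>UNIV. (1/3 * d2 i j k l) * killing_product a i k j l (x, p))"
  proof -
    let ?g = "\<lambda>i j k l. d2 i j k l * (x $ i * x $ j * p $ k * p $ l)"
    have "(1/3 * d2 i j k l) * killing_product a i k j l (x, p) =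
        1/3 * (d2 i j k l * ((x $ i * p $ k - x $ k * p $ i) * (x $ j * p $ l - x $ l * p $ j)))" for i j k l
      using z2[of i j k l] by (cases "i = a \<or> j = a \<or> k = a \<or> l = a") (auto simp: killing_product_def killing_field_def hom_coord_def mom_coord_def)
    then have "(\<Sum>i\<in>UNIV. \<Sum>j\<in>UNIV. \<Sum>k\<in>UNIV. \<Sum>l\<in>UNIV. (1/3 * d2 i j k l) * killing_product a i k j l (x, p)) =
        1/3 * (\<Sum>i\<in>UNIV. \<Sum>j\<in>UNIV. \<Sum>k\<in>UNIV. \<Sum>l\<in>UNIV.
          d2 i j k l * ((x $ i * p $ k - x $ k * p $ i) * (x $ j * p $ l - x $ l * p $ j)))"
      by (simp only: sum_distrib_left)
    also have "\<dots> = (\<Sum>i\<in>UNIV. \<Sum>j\<in>UNIV. \<Sum>k\<in>UNIV. \<Sum>l\<in>UNIV. ?g i j k l)"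
      using sum_pluecker_quadratic[of d2 "\<lambda>i. x $ i" "\<lambda>i. p $ i", OF d2] by simp
    also have "\<dots> = (\<Sum>i\<in>UNIV. \<Sum>l\<in>UNIV. \<Sum>k\<in>UNIV. \<Sum>j\<in>UNIV. ?g i j k l)"
      by (intro sum.cong refl sum3_swap13)
    also have "\<dots> = (\<Sum>k\<in>UNIV. \<Sum>l\<in>UNIV. \<Sum>i\<in>UNIV. \<Sum>j\<in>UNIV. ?g i j k l)"
      by (rule sum3_swap13)
    finally show ?thesis by (simp only: sum_distrib_right mult.assoc)
  qed
  ultimately show ?thesis by (simp only: distrib_right sum.distrib)
qed

text \<open>The coefficients of \<open>f\<close> are attached to the monomials
  \<open>Y\<^sub>i Y\<^sub>j\<close> of its homogenization, where \<open>Y\<^sub>a = 1\<close> marks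
  the missing degrees. The coefficients at index \<open>a\<close> must vanish, since there
  \<open>Y\<^sub>a\<close> is 1 and not \<open>x\<^sub>a\<close>.\<close>

lemma potential_part_eq_stackel_integral_sum:
  fixes a :: "'n::finite"
  assumes sym: "\<And>i j. c2 i j = c2 j i" and z1: "c1 a = 0" and z2: "\<And>i. c2 a i = 0"
    and f: "f = c0 + (\<Sum>i\<in>UNIV. c1 i * x $ i) + (\<Sum>i\<in>UNIV. \<Sum>j\<in>UNIV. c2 i j * (x $ i * x $ j))"
    and df: "\<And>i. df i = c1 i + 2 * (\<Sum>j\<in>UNIV. c2 i j * x $ j)"
    and x: "x $ a \<noteq> 0"
  shows "(\<Sum>k\<in>UNIV. \<Sum>l\<in>UNIV. (2 * x $ a * (2 * c2 k l) - (if k = a then df l else 0) - (if l = a then df k else 0)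
        + (if k = l then f / x $ a else 0)) * (p $ k * p $ l)) =
      c0 * stackel_integral a a a (x, p) + (\<Sum>i\<in>UNIV. c1 i * stackel_integral a a i (x, p))
      + (\<Sum>i\<in>UNIV. \<Sum>j\<in>UNIV. c2 i j * stackel_integral a i j (x, p))"
proof -
  define e where "e = energy a (x, p)"
  define d where "d = (\<Sum>l\<in>UNIV. df l * p $ l)"
  have za: "c2 i j = 0" if "i = a \<or> j = a" for i j using that z2 sym[of i a] by auto
  have l: "(\<Sum>k\<in>UNIV. \<Sum>l\<in>UNIV. (2 * x $ a * (2 * c2 k l) - (if k = a then df l else 0) - (if l = a then df k else 0)
        + (if k = l then f / x $ a else 0)) * (p $ k * p $ l)) =
      4 * x $ a * (\<Sum>k\<in>UNIV. \<Sum>l\<in>UNIV. c2 k l * (p $ k * p $ l)) - 2 * p $ a * d + f * e"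
  proof -
    have 1: "(\<Sum>k\<in>UNIV. \<Sum>l\<in>UNIV. (if k = a then df l else 0) * (p $ k * p $ l)) = p $ a * d"
    proof -
      have "(\<Sum>l\<in>UNIV. (if k = a then df l else 0) * (p $ k * p $ l)) = (if k = a then p $ a * d else 0)" for k
        by (simp add: d_def sum_distrib_left mult_ac)
      then show ?thesis by simp
    qed
    have 2: "(\<Sum>k\<in>UNIV. \<Sum>l\<in>UNIV. (if l = a then df k else 0) * (p $ k * p $ l)) = p $ a * d"
      unfolding 1[symmetric] by (subst sum.swap) (simp add: mult_ac)
    have 3: "(\<Sum>k\<in>UNIV. \<Sum>l\<in>UNIV. (if k = l then f / x $ a else 0) * (p $ k * p $ l)) = f * e"
    proof -
      have "(\<Sum>l\<in>UNIV. (if k = l then f / x $ a else 0) * (p $ k * p $ l)) = f / x $ a * (p $ k * p $ k)" for k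
        by (simp add: if_distrib if_distribR cong: if_cong)
      then show ?thesis
        by (simp add: e_def energy_def inner_vec_def sum_distrib_left sum_divide_distrib mult.assoc)
    qed
    have 4: "(\<Sum>k\<in>UNIV. \<Sum>l\<in>UNIV. (2 * x $ a * (2 * c2 k l)) * (p $ k * p $ l)) =
        4 * x $ a * (\<Sum>k\<in>UNIV. \<Sum>l\<in>UNIV. c2 k l * (p $ k * p $ l))"
      unfolding sum_distrib_left by (intro sum.cong refl) simp
    show ?thesis unfolding distrib_right left_diff_distrib sum.distrib sum_subtractf 1 2 3 4 by simp
  qed
  have s0: "stackel_integral a a a (x, p) = e" by (simp add: stackel_integral_def e_def hom_coord_def mom_coord_def)
  have s1: "c1 i * stackel_integral a a i (x, p) = (c1 i * x $ i) * e - 2 * p $ a * (c1 i * p $ i)" for i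
    using z1 by (cases "i = a") (auto simp: stackel_integral_def e_def hom_coord_def mom_coord_def algebra_simps)
  have s2: "c2 i j * stackel_integral a i j (x, p) = (c2 i j * (x $ i * x $ j)) * e
      - 2 * p $ a * (c2 i j * (p $ i * x $ j)) - 2 * p $ a * (c2 i j * (x $ i * p $ j))
      + 4 * x $ a * (c2 i j * (p $ i * p $ j))" for i j
    using za[of i j] by (cases "i = a \<or> j = a") (auto simp: stackel_integral_def e_def hom_coord_def mom_coord_def algebra_simps)
  have sw: "(\<Sum>i\<in>UNIV. \<Sum>j\<in>UNIV. c2 i j * (x $ i * p $ j)) = (\<Sum>i\<in>UNIV. \<Sum>j\<in>UNIV. c2 i j * (p $ i * x $ j))"
    by (subst sum.swap) (simp add: sym mult.commute)
  have d: "d = (\<Sum>i\<in>UNIV. c1 i * p $ i) + 2 * (\<Sum>i\<in>UNIV. \<Sum>j\<in>UNIV. c2 i j * (p $ i * x $ j))"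
  proof -
    have "df l * p $ l = c1 l * p $ l + (\<Sum>j\<in>UNIV. 2 * (c2 l j * (p $ l * x $ j)))" for l
      by (simp add: df sum_distrib_left algebra_simps)
    then show ?thesis by (simp only: d_def sum.distrib sum_distrib_left)
  qed
  have "c0 * stackel_integral a a a (x, p) + (\<Sum>i\<in>UNIV. c1 i * stackel_integral a a i (x, p)) + (\<Sum>i\<in>UNIV. \<Sum>j\<in>UNIV. c2 i j * stackel_integral a i j (x, p)) =
      c0 * e + ((\<Sum>i\<in>UNIV. c1 i * x $ i) * e - 2 * p $ a * (\<Sum>i\<in>UNIV. c1 i * p $ i))
      + ((\<Sum>i\<in>UNIV. \<Sum>j\<in>UNIV. c2 i j * (x $ i * x $ j)) * e
        - 2 * p $ a * (\<Sum>i\<in>UNIV. \<Sum>j\<in>UNIV. c2 i j * (p $ i * x $ j))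
        - 2 * p $ a * (\<Sum>i\<in>UNIV. \<Sum>j\<in>UNIV. c2 i j * (x $ i * p $ j))
        + 4 * x $ a * (\<Sum>i\<in>UNIV. \<Sum>j\<in>UNIV. c2 i j * (p $ i * p $ j)))"
    unfolding s0 s1 s2 by (simp only: sum.distrib sum_subtractf sum_distrib_left sum_distrib_right)
  also have "\<dots> = 4 * x $ a * (\<Sum>k\<in>UNIV. \<Sum>l\<in>UNIV. c2 k l * (p $ k * p $ l)) - 2 * p $ a * d + f * e"
    unfolding sw d f distrib_left distrib_right by linarith
  finally show ?thesis using l by linarith
qed

text \<open>All identities between coefficients are obtained by evaluating derivatives of
  \<open>K\<close> at a single point \<open>x0\<close>; the second-order ones come first because the
  lower ones are simplified with them.\<close>

lemma killing_polynomial_coefficients: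
  fixes K :: "'n::finite \<Rightarrow> 'n \<Rightarrow> real^'n \<Rightarrow> real"
  assumes V: "open V" "connected V" "V \<noteq> {}"
    and S: "\<And>k l. smooth_on V (K k l)" and sym: "\<And>k l. K k l = K l k"
    and Ka: "\<And>l. K a l = (\<lambda>x. 0)" and aK: "\<And>k l x. x \<in> V \<Longrightarrow> pd a (K k l) x = 0"
    and killing: "\<And>i k l x. x \<in> V \<Longrightarrow> pd i (K k l) x + pd k (K l i) x + pd l (K i k) x = 0"
  obtains d0 d1 d2 where
    "\<And>k l x. x \<in> V \<Longrightarrow> K k l x = d0 k l + (\<Sum>i\<in>UNIV. d1 i k l * x $ i)
      + (\<Sum>i\<in>UNIV. \<Sum>j\<in>UNIV. d2 i j k l * (x $ i * x $ j))"
    "\<And>i k l. d1 i k l = d1 i l k" "\<And>i k l. d1 i k l + d1 k l i + d1 l i k = 0"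
    "\<And>i j k l. d2 i j k l = d2 j i k l" "\<And>i j k l. d2 i j k l = d2 i j l k"
    "\<And>i j k l. d2 i j k l + d2 i k l j + d2 i l j k = 0"
    "\<And>k l. k = a \<or> l = a \<Longrightarrow> d0 k l = 0"
    "\<And>i k l. i = a \<or> k = a \<or> l = a \<Longrightarrow> d1 i k l = 0"
    "\<And>i j k l. i = a \<or> j = a \<or> k = a \<or> l = a \<Longrightarrow> d2 i j k l = 0"
proof -
  obtain x0 where x0: "x0 \<in> V" using V(3) by blast
  \<comment> \<open>Packing the three coefficient families into one triple lets a single choice
    produce them as functions of \<open>k\<close> and \<open>l\<close>.\<close>
  define Q where "Q k l = (\<lambda>(c0, c1, c2). (\<forall>i j. \<forall>x\<in>V. pd i (pd j (K k l)) x = 2 * c2 i j) \<and>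
    (\<forall>i. \<forall>x\<in>V. pd i (K k l) x = c1 i + 2 * (\<Sum>j\<in>UNIV. c2 i j * x $ j)) \<and>
    (\<forall>x\<in>V. K k l x = c0 + (\<Sum>i\<in>UNIV. c1 i * x $ i) + (\<Sum>i\<in>UNIV. \<Sum>j\<in>UNIV. c2 i j * (x $ i * x $ j))))"
    for k l
  have "\<exists>t. Q k l t" for k l
    using quadratic_polynomial[OF V S flat_killing_third_derivatives[OF V(1) S sym killing], of k l]
    unfolding Q_def by fastforce
  then obtain t where t: "\<And>k l. Q k l (t k l)" by metis
  define c0 c1 c2 where "c0 k l = fst (t k l)" and "c1 k l = fst (snd (t k l))" and "c2 k l = snd (snd (t k l))" for k l
  have
    c2: "pd i (pd j (K k l)) x = 2 * c2 k l i j" and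
    c1: "pd i (K k l) x = c1 k l i + 2 * (\<Sum>j\<in>UNIV. c2 k l i j * x $ j)" and
    c0: "K k l x = c0 k l + (\<Sum>i\<in>UNIV. c1 k l i * x $ i)
      + (\<Sum>i\<in>UNIV. \<Sum>j\<in>UNIV. c2 k l i j * (x $ i * x $ j))" if "x \<in> V" for k l i j x
    using t[of k l] that unfolding Q_def c0_def c1_def c2_def split_beta by blast+
  have sym2: "c2 k l i j = c2 l k i j" for k l i j
    using c2[OF x0, of i j k l] c2[OF x0, of i j l k] sym[of k l] by simp
  have sym1: "c1 k l i = c1 l k i" for k l i
    using c1[OF x0, of i k l] c1[OF x0, of i l k] sym[of k l] sym2[of k l] by simp
  have sym0: "c0 k l = c0 l k" for k l
    using c0[OF x0, of k l] c0[OF x0, of l k] sym[of k l] sym2[of k l] sym1[of k l] by simp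
  have comm: "c2 k l i j = c2 k l j i" for k l i j
    using c2[OF x0, of i j k l] c2[OF x0, of j i k l] dir_deriv_commute[OF V(1) S x0] by simp
  have za2: "c2 a l i j = 0" for l i j using c2[OF x0, of i j a l] by (simp add: Ka dir_deriv_const[abs_def])
  have za1: "c1 a l i = 0" for l i using c1[OF x0, of i a l] by (simp add: Ka za2 dir_deriv_const)
  have za0: "c0 a l = 0" for l using c0[OF x0, of a l] by (simp add: Ka za1 za2)
  have zj2: "c2 k l j a = 0" for k l j
  proof -
    have "pd j (pd a (K k l)) x0 = pd j (\<lambda>x. 0) x0" by (rule dir_deriv_cong[OF V(1) x0]) (rule aK)
    then show ?thesis using c2[OF x0, of j a k l] by (simp add: dir_deriv_const)
  qed
  have zi1: "c1 k l a = 0" for k l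
    using c1[OF x0, of a k l] aK[OF x0, of k l] by (simp add: comm[of k l a] zj2)
  have cyc2: "c2 k l i j + c2 l j i k + c2 j k i l = 0" for i j k l
  proof -
    have "pd i (\<lambda>x. pd j (K k l) x + pd k (K l j) x + pd l (K j k) x) x0 = pd i (\<lambda>x. 0) x0"
      by (rule dir_deriv_cong[OF V(1) x0]) (rule killing)
    then have "pd i (pd j (K k l)) x0 + pd i (pd k (K l j)) x0 + pd i (pd l (K j k)) x0 = 0"
      by (simp add: dir_deriv_add[OF _ _ x0] smooth_on_add smooth_on_dir_deriv S V(1) dir_deriv_const)
    then show ?thesis by (simp add: c2[OF x0])
  qed
  have cyc1: "c1 k l i + c1 l i k + c1 i k l = 0" for i k l
  proof -
    \<comment> \<open>The quadratic coefficients drop out of the Killing equation at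
      \<open>x0\<close> by \<open>cyc2\<close>, which leaves the linear ones.\<close>
    have "(\<Sum>j\<in>UNIV. c2 k l i j * x0 $ j) + (\<Sum>j\<in>UNIV. c2 l i k j * x0 $ j) + (\<Sum>j\<in>UNIV. c2 i k l j * x0 $ j) = 0"
      unfolding sum.distrib[symmetric] distrib_right[symmetric]
    proof (intro sum.neutral ballI)
      fix j
      have "c2 k l i j + c2 l i k j + c2 i k l j = 0"
        using cyc2[of k l j i] comm[of k l i j] comm[of l i k j] comm[of i k l j] by simp
      then show "(c2 k l i j + c2 l i k j + c2 i k l j) * x0 $ j = 0" by simp
    qed
    then show ?thesis using killing[OF x0, of i k l] by (simp add: c1[OF x0])
  qed
  show ?thesis
  proof (rule that[of c0 "\<lambda>i k l. c1 k l i" "\<lambda>i j k l. c2 k l i j"])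
    show "K k l x = c0 k l + (\<Sum>i\<in>UNIV. c1 k l i * x $ i) + (\<Sum>i\<in>UNIV. \<Sum>j\<in>UNIV. c2 k l i j * (x $ i * x $ j))"
      if "x \<in> V" for k l x using that by (rule c0)
    show "c1 k l i = c1 l k i" for i k l by (rule sym1)
    show "c1 k l i + c1 l i k + c1 i k l = 0" for i k l by (rule cyc1)
    show "c2 k l i j = c2 k l j i" for i j k l by (rule comm)
    show "c2 k l i j = c2 l k i j" for i j k l by (rule sym2)
    show "c2 k l i j + c2 l j i k + c2 j k i l = 0" for i j k l by (rule cyc2)
    show "c0 k l = 0" if "k = a \<or> l = a" for k l using that za0 sym0[of k a] by auto
    show "c1 k l i = 0" if "i = a \<or> k = a \<or> l = a" for i k l using that za1 zi1 sym1[of k a] by auto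
    show "c2 k l i j = 0" if "i = a \<or> j = a \<or> k = a \<or> l = a" for i j k l
      using that za2 zj2 comm[of k l a j] sym2[of k a] by auto
  qed
qed

lemma quadratic_integrals_subset_span:
  fixes V :: "(real^'n::finite) set" and r :: "'n \<Rightarrow> nat"
  assumes V: "open V" "connected V" "V \<noteq> {}" "V \<subseteq> {x. 0 < x $ a}" and r: "inj r"
  shows "quadratic_integrals V (affine_metric a)
    \<subseteq> fun_space.span (basis_fun a V ` (std_pairs r <+> std_quads r))"
proof
  fix F assume F: "F \<in> quadratic_integrals V (affine_metric a)"
  show "F \<in> fun_space.span (basis_fun a V ` (std_pairs r <+> std_quads r))"
  proof (rule quadratic_integral_components[OF V(1,4) F])
    fix u :: "'n \<Rightarrow> 'n \<Rightarrow> real^'n \<Rightarrow> real"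
    assume u: "\<And>k l. smooth_on V (u k l)" "\<And>k l. u k l = u l k"
    "\<And>x p. x \<in> V \<Longrightarrow> F (x, p) = (\<Sum>k\<in>UNIV. \<Sum>l\<in>UNIV. u k l x * (p $ k * p $ l))"
    "\<And>i k l x. x \<in> V \<Longrightarrow> x $ a * (pd i (u k l) x + pd k (u l i) x + pd l (u i k) x) +
      ((if i = k then u a l x else 0) + (if k = l then u a i x else 0) + (if l = i then u a k x else 0)) = 0"
    show ?thesis
    proof (rule integral_components_structure[OF V(1,4) u(1,2,4)])
      fix f and K :: "'n \<Rightarrow> 'n \<Rightarrow> real^'n \<Rightarrow> real"
      assume f: "smooth_on V f" "\<And>x. x \<in> V \<Longrightarrow> pd a f x = 0"
        "\<And>i j k x. x \<in> V \<Longrightarrow> pd i (pd j (pd k f)) x = 0"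
      and K: "\<And>k l. smooth_on V (K k l)" "\<And>k l. K k l = K l k" "\<And>l. K a l = (\<lambda>x. 0)"
        "\<And>k l x. x \<in> V \<Longrightarrow> pd a (K k l) x = 0"
        "\<And>i k l x. x \<in> V \<Longrightarrow> pd i (K k l) x + pd k (K l i) x + pd l (K i k) x = 0"
      and uK: "\<And>k l x. x \<in> V \<Longrightarrow> u k l x = K k l x + 2 * x $ a * pd k (pd l f) x
        - (if k = a then pd l f x else 0) - (if l = a then pd k f x else 0) + (if k = l then f x / x $ a else 0)"
      obtain c0 c1 c2 where
      c: "\<And>i j x. x \<in> V \<Longrightarrow> pd i (pd j f) x = 2 * c2 i j"
        "\<And>i x. x \<in> V \<Longrightarrow> pd i f x = c1 i + 2 * (\<Sum>j\<in>UNIV. c2 i j * x $ j)"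
        "\<And>x. x \<in> V \<Longrightarrow> f x = c0 + (\<Sum>i\<in>UNIV. c1 i * x $ i) + (\<Sum>i\<in>UNIV. \<Sum>j\<in>UNIV. c2 i j * (x $ i * x $ j))"
      using quadratic_polynomial[OF V(1-3) f(1,3)] by blast
      show ?thesis
      proof (rule killing_polynomial_coefficients[OF V(1-3) K])
        fix d0 d1 d2
        assume d:
          "\<And>k l x. x \<in> V \<Longrightarrow> K k l x = d0 k l + (\<Sum>i\<in>UNIV. d1 i k l * x $ i)
            + (\<Sum>i\<in>UNIV. \<Sum>j\<in>UNIV. d2 i j k l * (x $ i * x $ j))"
          "\<And>i k l. d1 i k l = d1 i l k" "\<And>i k l. d1 i k l + d1 k l i + d1 l i k = 0"
          "\<And>i j k l. d2 i j k l = d2 j i k l" "\<And>i j k l. d2 i j k l = d2 i j l k"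
          "\<And>i j k l. d2 i j k l + d2 i k l j + d2 i l j k = 0"
          "\<And>k l. k = a \<or> l = a \<Longrightarrow> d0 k l = 0"
          "\<And>i k l. i = a \<or> k = a \<or> l = a \<Longrightarrow> d1 i k l = 0"
          "\<And>i j k l. i = a \<or> j = a \<or> k = a \<or> l = a \<Longrightarrow> d2 i j k l = 0"
        obtain x0 where x0: "x0 \<in> V" using V(3) by blast
        have c2sym: "c2 i j = c2 j i" for i j
          using c(1)[OF x0, of i j] c(1)[OF x0, of j i] dir_deriv_commute[OF V(1) f(1) x0] by simp
        have c2a: "c2 a i = 0" for i
        proof -
          have "pd i (pd a f) x0 = pd i (\<lambda>x. 0) x0" by (rule dir_deriv_cong[OF V(1) x0]) (rule f(2))
          then show ?thesis using c(1)[OF x0, of i a] c2sym[of a i] by (simp add: dir_deriv_const)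
        qed
        have c1a: "c1 a = 0" using c(2)[OF x0, of a] f(2)[OF x0] by (simp add: c2a)
        let ?S = "\<lambda>i j. extend_zero V (stackel_integral a i j)" and ?K = "\<lambda>i j k l. extend_zero V (killing_product a i j k l)"
        \<comment> \<open>The coefficients of \<open>f\<close> select the integrals of Staeckel
          type, those of \<open>K\<close> the products of Killing fields. Truncation makes the
          equality with \<open>F\<close> hold off \<open>V\<close> as well.\<close>
        define G where "G = fun_scale c0 (?S a a) + (\<Sum>i\<in>UNIV. fun_scale (c1 i) (?S a i))
          + (\<Sum>i\<in>UNIV. \<Sum>j\<in>UNIV. fun_scale (c2 i j) (?S i j))
          + ((\<Sum>k\<in>UNIV. \<Sum>l\<in>UNIV. fun_scale (d0 k l) (?K a k a l))
          + (\<Sum>i\<in>UNIV. \<Sum>k\<in>UNIV. \<Sum>l\<in>UNIV. fun_scale (2/3 * d1 i k l) (?K i k a l))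
          + (\<Sum>i\<in>UNIV. \<Sum>j\<in>UNIV. \<Sum>k\<in>UNIV. \<Sum>l\<in>UNIV. fun_scale (1/3 * d2 i j k l) (?K i k j l)))"
        have "F (x, p) = G (x, p)" for x p
        proof (cases "x \<in> V")
          case True
          have xa: "x $ a \<noteq> 0" using True V(4) by auto
          have killing: "(\<Sum>k\<in>UNIV. \<Sum>l\<in>UNIV. K k l x * (p $ k * p $ l)) =
              (\<Sum>k\<in>UNIV. \<Sum>l\<in>UNIV. d0 k l * killing_product a a k a l (x, p))
              + (\<Sum>i\<in>UNIV. \<Sum>k\<in>UNIV. \<Sum>l\<in>UNIV. (2/3 * d1 i k l) * killing_product a i k a l (x, p))
              + (\<Sum>i\<in>UNIV. \<Sum>j\<in>UNIV. \<Sum>k\<in>UNIV. \<Sum>l\<in>UNIV. (1/3 * d2 i j k l) * killing_product a i k j l (x, p))"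
            unfolding d(1)[OF True] by (rule killing_form_eq_killing_product_sum[where a = a]) (fact d)+
          have "F (x, p) =
              (\<Sum>k\<in>UNIV. \<Sum>l\<in>UNIV. (2 * x $ a * (2 * c2 k l) - (if k = a then pd l f x else 0)
                - (if l = a then pd k f x else 0) + (if k = l then f x / x $ a else 0)) * (p $ k * p $ l))
              + (\<Sum>k\<in>UNIV. \<Sum>l\<in>UNIV. K k l x * (p $ k * p $ l))"
            unfolding u(3)[OF True] uK[OF True] c(1)[OF True] sum.distrib[symmetric]
            by (intro sum.cong refl) (simp only: distrib_right left_diff_distrib)
          also have "\<dots> = G (x, p)"
            unfolding potential_part_eq_stackel_integral_sum[OF c2sym c1a c2a c(3)[OF True] c(2)[OF True] xa]
              killing
            using True by (simp add: G_def sum_fun_eval fun_scale_def extend_zero_def)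
          finally show ?thesis .
        next
          case False
          then show ?thesis using F
            by (simp add: quadratic_integrals_def G_def sum_fun_eval fun_scale_def extend_zero_def)
        qed
        then have "F = G" by (auto simp: fun_eq_iff)
        also have "G \<in> fun_space.span (basis_fun a V ` (std_pairs r <+> std_quads r))"
          unfolding G_def
          by (intro fun_space.span_add fun_space.span_sum fun_space.span_scale stackel_integral_in_span killing_product_in_span[OF r])
        finally show ?thesis .
      qed
    qed
  qed
qed

lemma quadratic_integrals_dim_affine_metric:
  fixes V :: "(real^'n::finite) set" and r :: "'n \<Rightarrow> nat"
  assumes V: "open V" "connected V" "V \<noteq> {}" "V \<subseteq> {x. 0 < x $ a}" and r: "inj r"
  shows "quadratic_integrals_dim V (affine_metric a) (card (std_pairs r) + card (std_quads r))"
proof -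
  let ?J = "std_pairs r <+> std_quads r" and ?E = "basis_fun a V"
  have fin: "finite ?J" by simp
  note ind = independent_family[of ?J ?E, OF fin basis_fun_coeffs_zero[OF r V(1,3,4)]]
  have sub: "?E ` ?J \<subseteq> quadratic_integrals V (affine_metric a)"
    using stackel_integral_mem[OF V(1,4)] killing_product_mem[OF V(1,4)] by (auto simp: basis_fun_def)
  note span = quadratic_integrals_subset_span[OF V r]
  have "fun_space.dim (quadratic_integrals V (affine_metric a)) = card (?E ` ?J)"
    using fun_space.basis_card_eq_dim[OF sub span ind(2)] by simp
  also have "\<dots> = card (std_pairs r) + card (std_quads r)"
    using card_image[OF ind(1)] by (simp add: card_Plus)
  finally show ?thesis
    using span fin by (auto simp: quadratic_integrals_dim_def intro!: exI[of _ "?E ` ?J"])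
qed

theorem proposition2:
  assumes "CARD('n::finite) \<ge> 2"
  shows "real (submax_dim TYPE('n)) \<ge>
    real CARD('n) * (real CARD('n) + 1) / 2 + (real CARD('n))^2 * ((real CARD('n))^2 - 1) / 12"
proof -
  define n where "n = real CARD('n)"
  have n: "n \<ge> 2" using assms by (simp add: n_def)
  obtain r :: "'n \<Rightarrow> nat" where r: "bij_betw r UNIV {..<CARD('n)}"
    using ex_bij_betw_finite_nat[OF finite[of "UNIV :: 'n set"]] by (auto simp: atLeast0LessThan)
  then have inj: "inj r" by (simp add: bij_betw_def)
  define d where "d = card (std_pairs r) + card (std_quads r)"
  have "real (2 * card (std_pairs r)) = real (CARD('n) * (CARD('n) + 1))"
    "real (12 * card (std_quads r) + CARD('n)^2) = real (CARD('n)^4)"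
    using card_std_pairs[OF r] card_std_quads[OF r] by presburger+
  then have d: "real d = n * (n + 1) / 2 + n^2 * (n^2 - 1) / 12"
    by (simp add: d_def n_def field_simps power2_eq_square power4_eq_xxxx)
  fix a :: 'n
  let ?U = "{x :: real^'n. 0 < x $ a}"
  have U: "open ?U" by (intro open_Collect_less continuous_intros)
  \<comment> \<open>The count is the same on every connected open subset of the half-space, so the
    half-space itself serves as the bounding neighbourhood and all of its points are
    regular.\<close>
  have "local_dim_at (affine_metric a) x d" if "x \<in> ?U" for x
    unfolding local_dim_at_def d_def using U that
    by (intro exI[of _ ?U]) (auto intro!: quadratic_integrals_dim_affine_metric inj)
  then have "\<forall>\<^sub>F x in nhds (axis a 1). local_dim_at (affine_metric a) x d"
    using U by (auto simp: eventually_nhds intro!: exI[of _ ?U])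
  then have att: "d \<in> attained_dims TYPE('n)"
    unfolding attained_dims_def using U riemannian_affine_metric[of a]
    by (auto intro!: exI[of _ ?U] exI[of _ "affine_metric a"] exI[of _ "axis a 1"])
  \<comment> \<open>This gap is positive exactly because \<open>n\<close> is at least 2; in
    dimension 1 it would be zero.\<close>
  have "max_dim CARD('n) - real d = n * (n + 1) * (n - 1) / 3"
    unfolding d max_dim_def n_def[symmetric] by (simp add: field_simps power2_eq_square)
  moreover have "n * (n + 1) * (n - 1) / 3 > 0" using n by simp
  ultimately have "real d < max_dim CARD('n)" by linarith
  then have "d \<le> submax_dim TYPE('n)"
    unfolding submax_dim_def using att by (intro Max_ge finite_submaximal_dims) simp
  then show ?thesis using d by (simp add: n_def)
qed

end
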